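(* For all $k$-tuples of partitions $\boldsymbol\lambda,\boldsymbol\mu$ (regarded as having $\ell$ parts, with $\ell$ at least the number of nonzero parts of every component of $\boldsymbol\lambda,\boldsymbol\mu,\boldsymbol\lambda',\boldsymbol\mu'$) and all $n,m\ge0$, $$\mathcal L^S_{\boldsymbol\lambda/\boldsymbol\mu}(X_n;Y_m;t)=t^{g(\boldsymbol\lambda)-g(\boldsymbol\mu)}\,\mathcal L^S_{\boldsymbol\lambda'/\boldsymbol\mu'}(Y_m;X_n;t^{-1}).$$
   Context: Fix an integer $k\ge1$ (colours $1,\dots,k$) and an indeterminate $t$. For $\mathbf I\in\{0,1\}^k$ let $|\mathbf I|=\sum_cI_c$, and for $\mathbf I,\mathbf J\in\mathbb Z^k$ let $\varphi(\mathbf I,\mathbf J)=\sum_{1\le c<d\le k}I_cJ_d$. A vertex is a unit square whose bottom, left, top, right edges carry labels $\mathbf I,\mathbf J,\mathbf K,\mathbf L\in\{0,1\}^k$; $I_c=1$ means a path of colour $c$ uses that edge (paths move up and right). White weight: $W_x(\mathbf I,\mathbf J,\mathbf K,\mathbf L)=\mathbf 1_{\mathbf I+\mathbf J=\mathbf K+\mathbf L}\prod_c\mathbf 1_{I_c+J_c\ne2}\,x^{|\mathbf L|}t^{\varphi(\mathbf L,\mathbf I+\mathbf J)}$; purple weight: $P_x(\mathbf I,\mathbf J,\mathbf K,\mathbf L)=\mathbf 1_{\mathbf I+\mathbf J=\mathbf K+\mathbf L}\prod_c\mathbf 1_{K_c\ge J_c}\,x^{|\mathbf L|}t^{\varphi(\mathbf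 L,\mathbf K-\mathbf J)}$. For $k$-tuples of partitions $\boldsymbol\lambda,\boldsymbol\mu$ with $\ell$ parts and variables $X_n,Y_m$, consider the lattice with $n+m$ rows and columns $-\ell,\dots,N$ ($N$ large): rows $1,\dots,n$ from the bottom are white with parameters $x_1,\dots,x_n$, rows $n+1,\dots,n+m$ purple with parameters $y_1,\dots,y_m$; the bottom boundary edge of column $c$ carries colour $a$ iff $c=\mu^{(a)}_j-j$ for some $j$, the top boundary edge carries colour $a$ iff $c=\lambda^{(a)}_j-j$ for some $j$, left/right boundaries empty. $\mathcal L^S_{\boldsymbol\lambda/\boldsymbol\mu}(X_n;Y_m;t)$ is the sum over labellings of internal edges of the product of vertex weights; $\mathcal L^S_{\boldsymbol\lambda/\boldsymbol\mu}(Y_m;X_n;t)$ is the same with $m$ white rows carrying $y_1,\dots,y_m$ below $n$ purple rows carrying $x_1,\dots,x_n$. Conjugation: $\boldsymbol\lambda'=((\lambda^{(k)})',\dots,(\lambda^{(1)})')$, $\rho'$ the conjugate partition. The function $g$: for $k$-tuples $\boldsymbol\alpha,\boldsymbol\beta$ (with $\ell$ parts) such that $\alpha^{(a)}_1\ge\beta^{(a)}_1\ge\alpha^{(a)}_2\ge\beta^{(a)}_2\ge\cdots$ for all $a$, let $C$ be the configuration of a single white row with bottom boundary $\boldsymbol\beta$, top $\boldsymbol\alpha$, empty left/right boundaries, in which the path of colour $a$ entering at the bottom of column $\beta^{(a)}_j-j$ moves right and exits through the top of column $\alpha^{(a)}_j-j$. A box $b$ of $C$ is good for colours $i<j$ if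 either colour $i$ occupies the right edge of $b$ and colour $j$ occupies some edge of $b$, or colour $i$ occupies no edge of $b$ and colour $j$ occupies the left edge of $b$. Let $\tilde g(\boldsymbol\alpha/\boldsymbol\beta)$ be the number of triples $(b,i,j)$, $i<j$, with $b$ good for $i,j$. For $\boldsymbol\rho$ with $\ell$ parts let $\boldsymbol\beta^r$ ($0\le r\le\ell$) have components $(\rho^{(a)}_{\ell-r+1},\dots,\rho^{(a)}_\ell,0,\dots,0)$, and $g(\boldsymbol\rho)=\sum_{r=1}^\ell\tilde g(\boldsymbol\beta^r/\boldsymbol\beta^{r-1})$. *)

theory Defs
  imports Complex_Main "HOL-Library.FuncSet"
begin

section \<open>Partitions\<close>

text \<open>
  Parts are numbered from 1; the value at 0 is junk. A \<open>k\<close>-tuple of partitions is a function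
  from colours, of which only the values at \<open>1, \<dots>, k\<close> matter.
\<close>

type_synonym partition = "nat \<Rightarrow> nat"

definition is_partition :: "partition \<Rightarrow> bool" where
  "is_partition p \<longleftrightarrow> (\<forall>i j. 1 \<le> i \<longrightarrow> i \<le> j \<longrightarrow> p j \<le> p i) \<and> finite {i. 1 \<le> i \<and> p i \<noteq> 0}"

definition num_parts :: "partition \<Rightarrow> nat" where
  "num_parts p = card {i. 1 \<le> i \<and> p i \<noteq> 0}"

definition conj_partition :: "partition \<Rightarrow> partition" where
  "conj_partition p j = card {i. 1 \<le> i \<and> j \<le> p i}"

definition conj_tuple :: "nat \<Rightarrow> (nat \<Rightarrow> partition) \<Rightarrow> nat \<Rightarrow> partition" where
  "conj_tuple k lam a = conj_partition (lam (k + 1 - a))"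

section \<open>Vertex weights\<close>

text \<open>A vector in \<open>\<int>\<^sup>k\<close> is a function of which only the values at \<open>1, \<dots>, k\<close> matter.\<close>

type_synonym label = "nat \<Rightarrow> int"

definition labels :: "nat \<Rightarrow> label set" where
  "labels k = {1..k} \<rightarrow>\<^sub>E {0, 1}"

definition label_size :: "nat \<Rightarrow> label \<Rightarrow> int" where
  "label_size k I = (\<Sum>c = 1..k. I c)"

definition phi :: "nat \<Rightarrow> label \<Rightarrow> label \<Rightarrow> int" where
  "phi k I J = (\<Sum>(c, d) | 1 \<le> c \<and> c < d \<and> d \<le> k. I c * J d)"

text \<open>The label arguments are those of the bottom, left, top and right edges, in this order. The
  indeterminates are represented by elements of an arbitrary field; an identity valid over every
  field holds in particular for the variables of a field of rational functions.\<close>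

definition white_weight ::
    "nat \<Rightarrow> 'a::field \<Rightarrow> 'a \<Rightarrow> label \<Rightarrow> label \<Rightarrow> label \<Rightarrow> label \<Rightarrow> 'a" where
  "white_weight k t x I J K L =
     of_bool (\<forall>c\<in>{1..k}. I c + J c = K c + L c)
     * (\<Prod>c = 1..k. of_bool (I c + J c \<noteq> 2))
     * x powi label_size k L * t powi phi k L (\<lambda>c. I c + J c)"

definition purple_weight ::
    "nat \<Rightarrow> 'a::field \<Rightarrow> 'a \<Rightarrow> label \<Rightarrow> label \<Rightarrow> label \<Rightarrow> label \<Rightarrow> 'a" where
  "purple_weight k t x I J K L =
     of_bool (\<forall>c\<in>{1..k}. I c + J c = K c + L c)
     * (\<Prod>c = 1..k. of_bool (K c \<ge> J c))
     * x powi label_size k L * t powi phi k L (\<lambda>c. K c - J c)"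

section \<open>The lattice and its partition function\<close>

definition boundary_label :: "nat \<Rightarrow> nat \<Rightarrow> (nat \<Rightarrow> partition) \<Rightarrow> int \<Rightarrow> label" where
  "boundary_label k l lam c =
     (\<lambda>a\<in>{1..k}. of_bool (\<exists>j\<in>{1..l}. c = int (lam a j) - int j))"

definition empty_label :: "nat \<Rightarrow> label" where
  "empty_label k = (\<lambda>a\<in>{1..k}. 0)"

text \<open>
  A configuration on columns \<open>-l, \<dots>, N\<close> and rows \<open>1, \<dots>, R\<close> labels all edges:
  \<open>V (r, c)\<close> is the top edge of the box in row \<open>r\<close> and column \<open>c\<close> and the bottom edge of the box
  in row \<open>r + 1\<close>; \<open>H (r, c)\<close> is the left edge of the box in row \<open>r\<close> and column \<open>c\<close> and the right
  edge of the box in column \<open>c - 1\<close>. The boundary edges are prescribed, so summing over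
  configurations is summing over labellings of the internal edges. If \<open>R = 0\<close>, the bottom and the
  top boundary are the same edges, and there is a configuration only if their labels agree.
\<close>

definition configs ::
    "nat \<Rightarrow> nat \<Rightarrow> nat \<Rightarrow> nat \<Rightarrow> (nat \<Rightarrow> partition) \<Rightarrow> (nat \<Rightarrow> partition) \<Rightarrow>
     ((nat \<times> int \<Rightarrow> label) \<times> (nat \<times> int \<Rightarrow> label)) set" where
  "configs k l N R lam mu =
     {(V, H). V \<in> {0..R} \<times> {- int l..int N} \<rightarrow>\<^sub>E labels k
            \<and> H \<in> {1..R} \<times> {- int l..int N + 1} \<rightarrow>\<^sub>E labels k
            \<and> (\<forall>c\<in>{- int l..int N}. V (0, c) = boundary_label k l mu c
                                   \<and> V (R, c) = boundary_label k l lam c)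
            \<and> (\<forall>r\<in>{1..R}. H (r, - int l) = empty_label k \<and> H (r, int N + 1) = empty_label k)}"

text \<open>
  The function \<open>LS\<close> has \<open>n\<close> white rows with parameters \<open>x 1, \<dots>, x n\<close> below \<open>m\<close> purple rows with
  parameters \<open>y 1, \<dots>, y m\<close>.
\<close>

definition LS ::
    "nat \<Rightarrow> nat \<Rightarrow> nat \<Rightarrow> (nat \<Rightarrow> partition) \<Rightarrow> (nat \<Rightarrow> partition) \<Rightarrow>
     nat \<Rightarrow> (nat \<Rightarrow> 'a::field) \<Rightarrow> nat \<Rightarrow> (nat \<Rightarrow> 'a) \<Rightarrow> 'a \<Rightarrow> 'a" where
  "LS k l N lam mu n x m y t =
     (\<Sum>(V, H)\<in>configs k l N (n + m) lam mu. \<Prod>r = 1..n + m. \<Prod>c = - int l..int N.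
        (if r \<le> n then white_weight k t (x r) else purple_weight k t (y (r - n)))
          (V (r - 1, c)) (H (r, c)) (V (r, c)) (H (r, c + 1)))"

text \<open>
  How large \<open>N\<close> has to be: every path endpoint lies in one of the columns. Larger \<open>N\<close> only add
  empty columns, whose boxes have weight 1.
\<close>

definition fits :: "nat \<Rightarrow> nat \<Rightarrow> nat \<Rightarrow> (nat \<Rightarrow> partition) \<Rightarrow> bool" where
  "fits k l N lam \<longleftrightarrow> (\<forall>a\<in>{1..k}. \<forall>j\<in>{1..l}. int (lam a j) - int j \<le> int N)"

section \<open>The function g\<close>

text \<open>
  Occupied edges, for a single colour, of the box in column \<open>c\<close> of a white row in which the path
  entering at the bottom of column \<open>be j - j\<close> moves right and exits through the top of column
  \<open>al j - j\<close>.
\<close>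

definition occ_bottom :: "nat \<Rightarrow> partition \<Rightarrow> partition \<Rightarrow> int \<Rightarrow> bool" where
  "occ_bottom l al be c \<longleftrightarrow> (\<exists>j\<in>{1..l}. c = int (be j) - int j)"

definition occ_top :: "nat \<Rightarrow> partition \<Rightarrow> partition \<Rightarrow> int \<Rightarrow> bool" where
  "occ_top l al be c \<longleftrightarrow> (\<exists>j\<in>{1..l}. c = int (al j) - int j)"

definition occ_left :: "nat \<Rightarrow> partition \<Rightarrow> partition \<Rightarrow> int \<Rightarrow> bool" where
  "occ_left l al be c \<longleftrightarrow> (\<exists>j\<in>{1..l}. int (be j) - int j < c \<and> c \<le> int (al j) - int j)"

definition occ_right :: "nat \<Rightarrow> partition \<Rightarrow> partition \<Rightarrow> int \<Rightarrow> bool" where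
  "occ_right l al be c \<longleftrightarrow> (\<exists>j\<in>{1..l}. int (be j) - int j \<le> c \<and> c < int (al j) - int j)"

definition occ_some :: "nat \<Rightarrow> partition \<Rightarrow> partition \<Rightarrow> int \<Rightarrow> bool" where
  "occ_some l al be c \<longleftrightarrow>
     occ_bottom l al be c \<or> occ_left l al be c \<or> occ_top l al be c \<or> occ_right l al be c"

definition good_box ::
    "nat \<Rightarrow> (nat \<Rightarrow> partition) \<Rightarrow> (nat \<Rightarrow> partition) \<Rightarrow> int \<Rightarrow> nat \<Rightarrow> nat \<Rightarrow> bool" where
  "good_box l al be c i j \<longleftrightarrow>
     (occ_right l (al i) (be i) c \<and> occ_some l (al j) (be j) c) \<or>
     (\<not> occ_some l (al i) (be i) c \<and> occ_left l (al j) (be j) c)"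

text \<open>
  The row is unbounded to the right; the set is finite nevertheless, as colour \<open>j\<close> occupies an
  edge of every good box.
\<close>

definition g_tilde :: "nat \<Rightarrow> nat \<Rightarrow> (nat \<Rightarrow> partition) \<Rightarrow> (nat \<Rightarrow> partition) \<Rightarrow> nat" where
  "g_tilde k l al be =
     card {(c, i, j). - int l \<le> c \<and> 1 \<le> i \<and> i < j \<and> j \<le> k \<and> good_box l al be c i j}"

definition last_parts :: "nat \<Rightarrow> (nat \<Rightarrow> partition) \<Rightarrow> nat \<Rightarrow> nat \<Rightarrow> partition" where
  "last_parts l rho r a j = (if j \<le> r then rho a (l - r + j) else 0)"

definition g :: "nat \<Rightarrow> nat \<Rightarrow> (nat \<Rightarrow> partition) \<Rightarrow> nat" where
  "g k l rho = (\<Sum>r = 1..l. g_tilde k l (last_parts l rho r) (last_parts l rho (r - 1)))"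

end

theory Submission
  imports Defs
begin

text \<open>
  Conjugation swaps particles and holes, reflects the columns by \<open>c \<mapsto> -1 - c\<close> and reverses the
  colours. Vertex by vertex it turns a white row into a purple one with \<open>t\<close> inverted. The surplus
  powers of \<open>t\<close> of a row telescope to a difference of values of a function of the boundary, which
  differs from \<open>g\<close> by a constant since \<open>g\<close> is itself built from single white rows. The rows are then
  in the wrong order, with the purple rows below the white ones, and it remains to show that the
  transfer matrices of white and purple rows commute. This is done column by column: both orders
  reduce to a scalar recursion indexed by the set \<open>A\<close> of colours passing between adjacent columns,
  and these recursions are intertwined by \<open>\<Prod>i<|A|. (y + x t^i)\<close>.
\<close>

section \<open>Exchange of a white and a purple box\<close>

text \<open>Reflecting a box exchanges the roles of its left and right edges in \<open>phi\<close>;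
  reversing the colours undoes this, which is why conjugation has to reverse the tuple. Vertical
  edges are complemented, horizontal ones are not. Of the exponent of a white box the surplus
  \<open>phi k L I + phi k (\<lambda>c. 1 - K c) J\<close> is left over, and a pair of colours i < j
  contributes 1 to it exactly when the box is good for i and j. So over a single white row the
  surplus is at once \<open>g_tilde\<close> and a difference of values of \<open>height\<close>,
  which counts the pairs of a hole of colour c and a particle of colour d > c in the same column or
  further right.

  Commutation is wanted for empty outer edges only, but an induction over columns meets arbitrary
  labels in between. The intertwining factor can vanish in the field, so it is never cancelled;
  commutation is read off at the empty set, where it equals 1. All this takes place on the columns
  -l, ..., l - 1, the window that the reflection maps to itself.\<close>

definition inv_pairs :: "nat set \<Rightarrow> nat set \<Rightarrow> nat" where
  "inv_pairs A B = card {(c, d). c \<in> A \<and> d \<in> B \<and> c < d}"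

lemma inv_pairs_sum_left:
  assumes "finite A" "finite B"
  shows "inv_pairs A B = (\<Sum>c\<in>A. card {d\<in>B. c < d})"
proof -
  have "{(c, d). c \<in> A \<and> d \<in> B \<and> c < d} = (SIGMA c:A. {d\<in>B. c < d})" by auto
  then show ?thesis unfolding inv_pairs_def using assms by (simp add: card_SigmaI)
qed

lemma inv_pairs_Un_left:
  assumes "finite A" "finite B" "finite C" "A \<inter> B = {}"
  shows "inv_pairs (A \<union> B) C = inv_pairs A C + inv_pairs B C"
  using assms by (simp add: inv_pairs_sum_left sum.union_disjoint)

lemma inv_pairs_Un_right:
  assumes "finite A" "finite B" "finite C" "B \<inter> C = {}"
  shows "inv_pairs A (B \<union> C) = inv_pairs A B + inv_pairs A C"
proof -
  have "{(c, d). c \<in> A \<and> d \<in> B \<union> C \<and> c < d} =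
    {(c, d). c \<in> A \<and> d \<in> B \<and> c < d} \<union> {(c, d). c \<in> A \<and> d \<in> C \<and> c < d}" by auto
  moreover have "finite {(c, d). c \<in> A \<and> d \<in> D \<and> c < d}" if "finite D" for D
    by (rule finite_subset[of _ "A \<times> D"]) (use that assms in auto)
  ultimately show ?thesis
    unfolding inv_pairs_def using assms by (subst card_Un_disjoint[symmetric]) auto
qed

lemma inv_pairs_empty [simp]: "inv_pairs {} B = 0" "inv_pairs A {} = 0"
  by (simp_all add: inv_pairs_def)

lemma inv_pairs_sum_right:
  assumes "finite A" "finite B"
  shows "inv_pairs A B = (\<Sum>d\<in>B. inv_pairs A {d})"
  using assms(2,1)
proof (induction B rule: finite_induct)
  case (insert b B)
  then show ?case using inv_pairs_Un_right[of A "{b}" B] by simp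
qed simp

lemma inv_pairs_sum_left':
  assumes "finite A" "finite B"
  shows "inv_pairs A B = (\<Sum>c\<in>A. inv_pairs {c} B)"
  using assms
proof (induction A rule: finite_induct)
  case (insert b A)
  then show ?case using inv_pairs_Un_left[of "{b}" A B] by simp
qed simp

text \<open>Box weights with every edge replaced by the set of colours on it;
  \<open>inv_pairs\<close> is \<open>phi\<close> on indicator vectors.\<close>

definition white_set :: "'a::field \<Rightarrow> 'a \<Rightarrow> nat set \<Rightarrow> nat set \<Rightarrow> nat set \<Rightarrow> nat set \<Rightarrow> 'a" where
  "white_set t x I J K L =
    (if I \<inter> J = {} \<and> K \<inter> L = {} \<and> I \<union> J = K \<union> L then x ^ card L * t ^ inv_pairs L (I \<union> J) else 0)"

definition purple_set :: "'a::field \<Rightarrow> 'a \<Rightarrow> nat set \<Rightarrow> nat set \<Rightarrow> nat set \<Rightarrow> nat set \<Rightarrow> 'a" where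
  "purple_set t x I J K L =
    (if J \<subseteq> K \<and> L \<subseteq> I \<and> I - L = K - J then x ^ card L * t ^ inv_pairs L (I - L) else 0)"

text \<open>Up to a common factor, the weight with which the colours of \<open>A\<close> leave a
  column, white below purple, when those of \<open>W\<close> use the white row. For finite
  \<open>A\<close> the sum over all \<open>W \<subseteq> A\<close> factors colour by colour into
  \<open>qpoch t x y (card A)\<close>, a form of the q-binomial theorem.\<close>

definition split_weight :: "'a::field \<Rightarrow> 'a \<Rightarrow> 'a \<Rightarrow> nat set \<Rightarrow> nat set \<Rightarrow> 'a" where
  "split_weight t x y A W = x ^ card W * y ^ card (A - W) * t ^ inv_pairs W A"

definition qpoch :: "'a::field \<Rightarrow> 'a \<Rightarrow> 'a \<Rightarrow> nat \<Rightarrow> 'a" where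
  "qpoch t x y n = (\<Prod>i<n. y + x * t ^ i)"

text \<open>The threshold \<open>n\<close> interpolates between \<open>A\<close> and
  \<open>B\<close>: colours below it are counted by membership in \<open>B\<close>, the others by
  membership in \<open>A\<close>. Moving it past one colour changes the mixed cardinality by at most
  one, and the factor of \<open>qpoch\<close> gained or lost is the factor of the products at that
  colour.\<close>

lemma qpoch_step:
  assumes "finite A" "finite B"
  shows "qpoch t x y (card {d\<in>A. d \<ge> n} + card {d\<in>B. d < n}) *
          (\<Prod>c\<in>{c\<in>A - B. c < n}. y + x * t ^ (inv_pairs {c} A + inv_pairs B {c})) =
         qpoch t x y (card A) *
          (\<Prod>c\<in>{c\<in>B - A. c < n}. y + x * t ^ (inv_pairs {c} A + inv_pairs B {c}))"
proof (induction n)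
  case 0
  then show ?case by simp
next
  case (Suc n)
  \<comment> \<open>Number of counted colours other than \<open>n\<close>; it is also the exponent
    attached to \<open>n\<close> itself.\<close>
  define m where "m = card {d\<in>A. d \<ge> Suc n} + card {d\<in>B. d < n}"
  have 1: "{d\<in>A. d \<ge> n} = (if n \<in> A then insert n {d\<in>A. d \<ge> Suc n} else {d\<in>A. d \<ge> Suc n})"
    by (auto simp: le_less Suc_le_eq)
  have 2: "{d\<in>X. d < Suc n} = (if n \<in> X then insert n {d\<in>X. d < n} else {d\<in>X. d < n})" for X
    by (auto simp: less_Suc_eq)
  have fin: "finite {d\<in>A. d \<ge> Suc n}" "finite {d\<in>B. d < n}" using assms by auto
  have old: "card {d\<in>A. d \<ge> n} + card {d\<in>B. d < n} = m + of_bool (n \<in> A)"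
    unfolding m_def 1 using fin by auto
  have new: "card {d\<in>A. d \<ge> Suc n} + card {d\<in>B. d < Suc n} = m + of_bool (n \<in> B)"
    unfolding m_def 2 using fin by auto
  have "inv_pairs {n} A = card {d\<in>A. d \<ge> Suc n}"
    using assms by (simp add: inv_pairs_sum_left Suc_le_eq)
  moreover have "inv_pairs B {n} = card {d\<in>B. d < n}"
  proof -
    have "{(c, d). c \<in> B \<and> d \<in> {n} \<and> c < d} = (\<lambda>c. (c, n)) ` {d\<in>B. d < n}" by auto
    then show ?thesis unfolding inv_pairs_def by (simp add: card_image inj_on_def)
  qed
  ultimately have e: "inv_pairs {n} A + inv_pairs B {n} = m" by (simp add: m_def)
  let ?f = "\<lambda>c. y + x * t ^ (inv_pairs {c} A + inv_pairs B {c})"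
  have pr: "prod ?f {c\<in>X. c < Suc n} = (if n \<in> X then y + x * t ^ m else 1) * prod ?f {c\<in>X. c < n}"
    if "finite X" for X
    unfolding 2 using that by (simp add: e)
  have q: "qpoch t x y (Suc m) = qpoch t x y m * (y + x * t ^ m)" by (simp add: qpoch_def)
  have "finite (A - B)" "finite (B - A)" using assms by auto
  then show ?case
    using Suc.IH unfolding old new pr[OF \<open>finite (A - B)\<close>] pr[OF \<open>finite (B - A)\<close>]
    by (cases "n \<in> A"; cases "n \<in> B") (simp_all add: q mult_ac)
qed

text \<open>In \<open>column_exchange\<close>, \<open>A\<close> enters a column from the left and
  \<open>B\<close> leaves it on the right: the product over \<open>A - B\<close> comes from the
  colours turning up, the one over \<open>B - A\<close> from those turning right.\<close>

lemma qpoch_telescope: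
  assumes "finite A" "finite B"
  shows "qpoch t x y (card B) * (\<Prod>c\<in>A - B. y + x * t ^ (inv_pairs {c} A + inv_pairs B {c})) =
         qpoch t x y (card A) * (\<Prod>c\<in>B - A. y + x * t ^ (inv_pairs {c} A + inv_pairs B {c}))"
proof -
  obtain n where n: "\<forall>d\<in>A \<union> B. d < n"
    using assms finite_nat_set_iff_bounded[of "A \<union> B"] by auto
  then have "{d\<in>A. d \<ge> n} = {}" "{d\<in>B. d < n} = B" "{c\<in>A - B. c < n} = A - B" "{c\<in>B - A. c < n} = B - A"
    by (auto simp: not_le)
  then show ?thesis using qpoch_step[OF assms, of t x y n] by (simp only: card.empty add_0)
qed

text \<open>The colours of \<open>B\<close> leave to the right in any case, and only the row of each
  is free. The white exponent splits along \<open>I \<union> W = B \<union> (K - P)\<close>; its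
  part against \<open>K - P\<close> combines with the purple exponent into a factor that does not
  depend on the choice of rows.\<close>

lemma white_purple_column:
  fixes F :: "nat set \<Rightarrow> nat set \<Rightarrow> 'a::field"
    and I K W P :: "nat set"
  assumes "finite U" "I \<subseteq> U" "W \<subseteq> U"
  defines "B \<equiv> (I \<union> W) - (K - P)"
  shows "(\<Sum>M\<in>Pow U. \<Sum>W'\<in>Pow U. \<Sum>P'\<in>Pow U.
            white_set t x I W M W' * purple_set t y M P K P' * F W' P') =
         (if I \<inter> W = {} \<and> P \<subseteq> K \<and> K - P \<subseteq> I \<union> W
          then t ^ inv_pairs B (K - P) * (\<Sum>W'\<in>Pow B. split_weight t x y B W' * F W' (B - W'))
          else 0)" (is "?lhs = _")
proof -
  define f where "f = (\<lambda>(M, W', P'). white_set t x I W M W' * purple_set t y M P K P' * F W' P')"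
  define h where "h = (\<lambda>W'. ((I \<union> W) - W', W', B - W'))"
  have sub: "B \<subseteq> U" using assms(2,3) unfolding B_def by blast
  have fin: "finite B" "finite (K - P)" if "K - P \<subseteq> I \<union> W"
    using finite_subset[OF sub assms(1)] finite_subset[OF that] assms(1-3) by (auto intro: finite_subset)
  have nz: "I \<inter> W = {} \<and> P \<subseteq> K \<and> K - P \<subseteq> I \<union> W \<and> z \<in> h ` Pow B" if "f z \<noteq> 0" for z
  proof -
    obtain M W' P' where z: "z = (M, W', P')" by (cases z)
    from that have c: "I \<inter> W = {}" "M \<inter> W' = {}" "I \<union> W = M \<union> W'" "P \<subseteq> K" "P' \<subseteq> M" "M - P' = K - P"
      by (auto simp: f_def z white_set_def purple_set_def split: if_splits)
    have "W' \<subseteq> B" "M = (I \<union> W) - W'" "P' = B - W'" using c unfolding B_def by blast+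
    then have "z = h W'" "W' \<in> Pow B" by (auto simp: z h_def)
    moreover have "K - P \<subseteq> I \<union> W" using c by blast
    ultimately show ?thesis using c by blast
  qed
  have "(\<Sum>M\<in>Pow U. \<Sum>W'\<in>Pow U. \<Sum>P'\<in>Pow U.
            white_set t x I W M W' * purple_set t y M P K P' * F W' P') =
        sum f (Pow U \<times> Pow U \<times> Pow U)"
    by (simp add: f_def sum.cartesian_product)
  also have "\<dots> = (if I \<inter> W = {} \<and> P \<subseteq> K \<and> K - P \<subseteq> I \<union> W then sum f (h ` Pow B) else 0)"
  proof (cases "I \<inter> W = {} \<and> P \<subseteq> K \<and> K - P \<subseteq> I \<union> W")
    case True
    have "h ` Pow B \<subseteq> Pow U \<times> Pow U \<times> Pow U" using sub assms(2,3) by (auto simp: h_def)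
    then have "sum f (Pow U \<times> Pow U \<times> Pow U) = sum f (h ` Pow B)"
      using assms(1) nz by (intro sum.mono_neutral_right) (simp, simp, blast)
    then show ?thesis using True by simp
  next
    case False
    then have "f z = 0" for z using nz[of z] by blast
    then show ?thesis using False by (simp only: if_False) (simp add: sum.neutral)
  qed
  finally have tot: "?lhs = (if I \<inter> W = {} \<and> P \<subseteq> K \<and> K - P \<subseteq> I \<union> W then sum f (h ` Pow B) else 0)" .
  have "sum f (h ` Pow B) = t ^ inv_pairs B (K - P) *
      (\<Sum>W'\<in>Pow B. split_weight t x y B W' * F W' (B - W'))"
    if c: "I \<inter> W = {} \<and> P \<subseteq> K \<and> K - P \<subseteq> I \<union> W"
  proof -
    have "inj_on h (Pow B)" by (auto simp: inj_on_def h_def)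
    then have "sum f (h ` Pow B) = (\<Sum>W'\<in>Pow B. f (h W'))" by (simp add: sum.reindex)
    also have "\<dots> = (\<Sum>W'\<in>Pow B. t ^ inv_pairs B (K - P) * (split_weight t x y B W' * F W' (B - W')))"
    proof (rule sum.cong)
      fix W' assume "W' \<in> Pow B"
      then have W': "W' \<subseteq> B" by simp
      have fin': "finite W'" "finite (B - W')" using fin c W' finite_subset by auto
      have IW: "I \<union> W = B \<union> (K - P)" "B \<inter> (K - P) = {}" using c unfolding B_def by auto
      have 1: "I \<union> W - W' - (B - W') = K - P" "B - W' \<subseteq> I \<union> W - W'" "W' \<subseteq> I \<union> W"
        "(I \<union> W - W') \<inter> W' = {}" "I \<union> W = I \<union> W - W' \<union> W'"
        using W' c unfolding B_def by blast+
      have w: "white_set t x I W (I \<union> W - W') W' = x ^ card W' * t ^ (inv_pairs W' B + inv_pairs W' (K - P))"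
      proof -
        have "inv_pairs W' (I \<union> W) = inv_pairs W' B + inv_pairs W' (K - P)"
          unfolding IW(1) using fin c fin' IW(2) by (intro inv_pairs_Un_right) auto
        then show ?thesis using 1(4) 1(5)[symmetric] c by (simp add: white_set_def)
      qed
      have p: "purple_set t y (I \<union> W - W') P K (B - W') = y ^ card (B - W') * t ^ inv_pairs (B - W') (K - P)"
        using 1 c by (simp add: purple_set_def)
      have "inv_pairs B (K - P) = inv_pairs (W' \<union> (B - W')) (K - P)" using W' by (simp add: Un_absorb1)
      also have "\<dots> = inv_pairs W' (K - P) + inv_pairs (B - W') (K - P)"
        using fin fin' c by (intro inv_pairs_Un_left) auto
      finally show "f (h W') = t ^ inv_pairs B (K - P) * (split_weight t x y B W' * F W' (B - W'))"
        by (simp add: f_def h_def w p split_weight_def power_add mult_ac)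
    qed simp
    finally show ?thesis by (simp add: sum_distrib_left)
  qed
  then show ?thesis using tot by simp
qed

text \<open>The point of this form is that, beyond disjointness, the incoming sets occur only
  through \<open>W \<union> P\<close>. The free choice is \<open>P'\<close>: it fixes the middle
  edge \<open>P \<union> (I - P')\<close>, and \<open>W'\<close> is then what the top edge
  \<open>K\<close> does not take.\<close>

lemma purple_white_column:
  fixes F :: "nat set \<Rightarrow> nat set \<Rightarrow> 'a::field"
    and I K W P :: "nat set"
  assumes "finite U" "I \<subseteq> U" "W \<subseteq> U" "P \<subseteq> U"
  shows "(\<Sum>M\<in>Pow U. \<Sum>P'\<in>Pow U. \<Sum>W'\<in>Pow U.
            purple_set t y I P M P' * white_set t x M W K W' * F W' P') =
         (if W \<inter> P = {} then
          (\<Sum>P' | P' \<subseteq> I \<and> (W \<union> P) \<inter> (I - P') = {} \<and> K \<subseteq> W \<union> P \<union> (I - P').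
             y ^ card P' * t ^ inv_pairs P' (I - P') * x ^ card (W \<union> P \<union> (I - P') - K)
               * t ^ inv_pairs (W \<union> P \<union> (I - P') - K) (W \<union> P \<union> (I - P'))
               * F (W \<union> P \<union> (I - P') - K) P') else 0)" (is "?lhs = _")
proof -
  define f where "f = (\<lambda>(M, P', W'). purple_set t y I P M P' * white_set t x M W K W' * F W' P')"
  define h where "h = (\<lambda>P'. (P \<union> (I - P'), P', W \<union> P \<union> (I - P') - K))"
  define S where "S = {P'. P' \<subseteq> I \<and> (W \<union> P) \<inter> (I - P') = {} \<and> K \<subseteq> W \<union> P \<union> (I - P')}"
  have nz: "W \<inter> P = {} \<and> z \<in> h ` S" if "f z \<noteq> 0" for z
  proof -
    obtain M W' P' where z: "z = (M, P', W')" by (cases z)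
    from that have c: "M \<inter> W = {}" "K \<inter> W' = {}" "M \<union> W = K \<union> W'" "P \<subseteq> M" "P' \<subseteq> I" "I - P' = M - P"
      by (auto simp: f_def z white_set_def purple_set_def split: if_splits)
    have "M = P \<union> (I - P')" using c by blast
    moreover have "W' = W \<union> P \<union> (I - P') - K" "P' \<in> S" using c unfolding S_def by blast+
    ultimately have "z = h P'" "P' \<in> S" by (auto simp: z h_def)
    moreover have "W \<inter> P = {}" using c by blast
    ultimately show ?thesis using c by blast
  qed
  have "(\<Sum>M\<in>Pow U. \<Sum>P'\<in>Pow U. \<Sum>W'\<in>Pow U.
            purple_set t y I P M P' * white_set t x M W K W' * F W' P') =
        sum f (Pow U \<times> Pow U \<times> Pow U)"
    by (simp add: f_def sum.cartesian_product)
  also have "\<dots> = (if W \<inter> P = {} then sum f (h ` S) else 0)"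
  proof (cases "W \<inter> P = {}")
    case True
    have "h ` S \<subseteq> Pow U \<times> Pow U \<times> Pow U" using assms by (auto simp: h_def S_def)
    then have "sum f (Pow U \<times> Pow U \<times> Pow U) = sum f (h ` S)"
      using assms(1) nz by (intro sum.mono_neutral_right) (simp, simp, blast)
    then show ?thesis using True by simp
  next
    case False
    then have "f z = 0" for z using nz[of z] by blast
    then show ?thesis using False by (simp only: if_False) (simp add: sum.neutral)
  qed
  finally have tot: "?lhs = (if W \<inter> P = {} then sum f (h ` S) else 0)" .
  have "sum f (h ` S) = (\<Sum>P'\<in>S. y ^ card P' * t ^ inv_pairs P' (I - P') * x ^ card (W \<union> P \<union> (I - P') - K)
               * t ^ inv_pairs (W \<union> P \<union> (I - P') - K) (W \<union> P \<union> (I - P'))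
               * F (W \<union> P \<union> (I - P') - K) P')" if "W \<inter> P = {}"
  proof -
    have "inj_on h S" by (auto simp: inj_on_def h_def)
    then have "sum f (h ` S) = (\<Sum>P'\<in>S. f (h P'))" by (simp add: sum.reindex)
    also have "\<dots> = (\<Sum>P'\<in>S. y ^ card P' * t ^ inv_pairs P' (I - P') * x ^ card (W \<union> P \<union> (I - P') - K)
               * t ^ inv_pairs (W \<union> P \<union> (I - P') - K) (W \<union> P \<union> (I - P'))
               * F (W \<union> P \<union> (I - P') - K) P')"
    proof (rule sum.cong)
      fix P' assume P': "P' \<in> S"
      have p: "purple_set t y I P (P \<union> (I - P')) P' = y ^ card P' * t ^ inv_pairs P' (I - P')"
        using P' by (auto simp: purple_set_def S_def)
      have *: "(P \<union> (I - P')) \<inter> W = {}" "K \<inter> (W \<union> P \<union> (I - P') - K) = {}"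
         "P \<union> (I - P') \<union> W = W \<union> P \<union> (I - P')" "K \<union> (W \<union> P \<union> (I - P') - K) = W \<union> P \<union> (I - P')"
        using P' that unfolding S_def by blast+
      have w: "white_set t x (P \<union> (I - P')) W K (W \<union> P \<union> (I - P') - K) = x ^ card (W \<union> P \<union> (I - P') - K)
               * t ^ inv_pairs (W \<union> P \<union> (I - P') - K) (W \<union> P \<union> (I - P'))"
        unfolding white_set_def * by simp
      show "f (h P') = y ^ card P' * t ^ inv_pairs P' (I - P') * x ^ card (W \<union> P \<union> (I - P') - K)
               * t ^ inv_pairs (W \<union> P \<union> (I - P') - K) (W \<union> P \<union> (I - P'))
               * F (W \<union> P \<union> (I - P') - K) P'"
        by (simp add: f_def h_def w p mult_ac)
    qed simp
    finally show ?thesis .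
  qed
  then show ?thesis using tot unfolding S_def by simp
qed

text \<open>
  \<open>A\<close> is the set of colours crossing the left side of the column in one of its two boxes. Below
  white, above purple, the outgoing weights are proportional to \<open>split_weight\<close>, whatever came in;
  in the opposite order the incoming distribution of the colours over the two rows is irrelevant.
  So only one scalar per \<open>A\<close> has to be compared, and the ratio of the two scalars is \<open>qpoch\<close>.
\<close>

lemma column_exchange:
  fixes FL FR :: "nat set \<Rightarrow> nat set \<Rightarrow> 'a::field"
  assumes U: "finite U" "A \<subseteq> U" "I \<subseteq> U" "K \<subseteq> U"
    and FR0: "\<And>W P. W \<subseteq> U \<Longrightarrow> P \<subseteq> U \<Longrightarrow> W \<inter> P \<noteq> {} \<Longrightarrow> FR W P = 0"
    and FR1: "\<And>W P. W \<subseteq> U \<Longrightarrow> P \<subseteq> U \<Longrightarrow> W \<inter> P = {} \<Longrightarrow> FR W P = FR {} (W \<union> P)"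
    and FL: "\<And>B. B \<subseteq> U \<Longrightarrow>
      (\<Sum>W\<in>Pow B. split_weight t x y B W * FL W (B - W)) = qpoch t x y (card B) * FR {} B"
  shows "(\<Sum>W\<in>Pow A. split_weight t x y A W *
            (\<Sum>M\<in>Pow U. \<Sum>W'\<in>Pow U. \<Sum>P'\<in>Pow U.
               white_set t x I W M W' * purple_set t y M (A - W) K P' * FL W' P')) =
         qpoch t x y (card A) *
            (\<Sum>M\<in>Pow U. \<Sum>P'\<in>Pow U. \<Sum>W'\<in>Pow U.
               purple_set t y I A M P' * white_set t x M {} K W' * FR W' P')"
    (is "(\<Sum>W\<in>_. _ * ?L W) = _ * ?R")
proof -
  define S where "S = {P'. P' \<subseteq> I \<and> A \<inter> (I - P') = {} \<and> K \<subseteq> A \<union> (I - P')}"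
  define rt where "rt = (\<lambda>P'. y ^ card P' * t ^ inv_pairs P' (I - P') * x ^ card (A \<union> (I - P') - K)
               * t ^ inv_pairs (A \<union> (I - P') - K) (A \<union> (I - P'))
               * FR (A \<union> (I - P') - K) P')"
  have R: "?R = sum rt S"
    using purple_white_column[OF U(1,3) _ U(2), of "{}" t y x K FR] by (simp add: S_def rt_def)
  \<comment> \<open>The incoming splits of \<open>A\<close> that survive, and what leaves the column
    then, both read off \<open>white_purple_column\<close> with \<open>P = A - W\<close>.\<close>
  define cond where "cond = (\<lambda>W. I \<inter> W = {} \<and> A - W \<subseteq> K \<and> K - (A - W) \<subseteq> I \<union> W)"
  define aft where "aft = (\<lambda>W. (I \<union> W) - (K - (A - W)))"
  have L: "?L W = (if cond W then t ^ inv_pairs (aft W) (K - (A - W)) * (qpoch t x y (card (aft W)) * FR {} (aft W)) else 0)"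
    if "W \<in> Pow A" for W
  proof -
    have "W \<subseteq> U" "aft W \<subseteq> U" using that U by (auto simp: aft_def)
    show ?thesis
      unfolding white_purple_column[OF U(1,3) \<open>W \<subseteq> U\<close>]
        FL[OF \<open>aft W \<subseteq> U\<close>, unfolded aft_def] cond_def aft_def by (rule refl)
  qed
  show ?thesis
  \<comment> \<open>A colour on the left and at the bottom has to leave through the top too, and the
    top carries only colours that came in. If this fails, no split is admissible on the left-hand
    side, and on the right-hand side any two outgoing sets overlap, so \<open>FR0\<close>
    applies.\<close>
  proof (cases "A \<inter> I \<subseteq> K \<and> K \<subseteq> A \<union> I")
    case False
    have "\<not> cond W" if "W \<in> Pow A" for W using False that by (auto simp: cond_def)
    then have "(\<Sum>W\<in>Pow A. split_weight t x y A W * ?L W) = 0" by (simp add: L)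
    moreover have "rt P' = 0" if "P' \<in> S" for P'
    proof -
      have "(A \<union> (I - P') - K) \<inter> P' \<noteq> {}" using False that by (auto simp: S_def)
      moreover have "A \<union> (I - P') - K \<subseteq> U" "P' \<subseteq> U" using U that by (auto simp: S_def)
      ultimately show ?thesis by (simp add: rt_def FR0)
    qed
    ultimately show ?thesis unfolding R by simp
  next
    case valid: True
    \<comment> \<open>Colours by their route through the pair of boxes: \<open>C0\<close> goes from
      left to right, \<open>C1\<close> is present on all four sides, \<open>T\<close> goes from
      bottom to top. The others turn: \<open>A \<inter> K - I\<close> upwards,
      \<open>I - K - A\<close> to the right. \<open>B\<close> is everything that leaves on the
      right.\<close>
    define C0 where "C0 = A - I - K"
    define C1 where "C1 = A \<inter> I"
    define T where "T = I \<inter> K - A"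
    define B where "B = C0 \<union> C1 \<union> (I - K - A)"
    have EB: "A - B = A \<inter> K - I" and SB: "B - A = I - K - A"
      using valid by (auto simp: B_def C0_def C1_def)
    have fin: "finite A" "finite I" "finite K"
      using U by (auto intro: finite_subset)
    have fin': "finite B" "finite C0" "finite C1" "finite T" using fin by (auto simp: B_def C0_def C1_def T_def)
    \<comment> \<open>\<open>e c\<close> is the power of \<open>t\<close> that a turning colour
      \<open>c\<close> costs in the white row; \<open>q\<close> collects the colours without a
      choice and is the same for both orders of the rows.\<close>
    define e where "e = (\<lambda>c. inv_pairs {c} A + inv_pairs B {c})"
    define q where "q = x ^ card C0 * y ^ card C1 * t ^ (inv_pairs C0 A + inv_pairs B T)"
    have BU: "B \<subseteq> U" using U by (auto simp: B_def C0_def C1_def)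
    have pe: "(\<Prod>c\<in>X. x * t ^ e c) = x ^ card X * t ^ (inv_pairs X A + inv_pairs B X)" if "finite X" for X
      using that fin(1) fin'(1)
      by (simp add: prod.distrib power_sum[symmetric] e_def sum.distrib inv_pairs_sum_left'[symmetric]
         inv_pairs_sum_right[symmetric])
    \<comment> \<open>Expansion of the product over subsets: \<open>Z\<close> is the set of turning
      colours that use the white row.\<close>
    have split: "sum w (Pow X) = q * (\<Prod>c\<in>X. y + x * t ^ e c)"
      if "finite X" "\<And>Z. Z \<subseteq> X \<Longrightarrow> w Z = q * (x ^ card Z * t ^ (inv_pairs Z A + inv_pairs B Z)) * y ^ card (X - Z)" for X w
    proof -
      have "sum w (Pow X) = (\<Sum>Z\<in>Pow X. q * ((\<Prod>c\<in>Z. x * t ^ e c) * (\<Prod>c\<in>X - Z. y)))"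
        using that pe by (intro sum.cong) (auto simp: finite_subset mult_ac)
      also have "\<dots> = q * (\<Prod>c\<in>X. x * t ^ e c + y)"
        using that(1) by (simp add: prod_add sum_distrib_left)
      finally show ?thesis by (simp add: add.commute)
    qed
    have "(\<Sum>W\<in>Pow A. split_weight t x y A W * ?L W) =
          (\<Sum>W | W \<in> Pow A \<and> cond W. split_weight t x y A W * ?L W)"
      using fin by (intro sum.mono_neutral_right) (auto simp: L)
    \<comment> \<open>Only \<open>A - B\<close> may choose its incoming row: a colour of
      \<open>C0\<close> in the purple box would be forced out through the top, and a colour of
      \<open>C1\<close> already occupies the bottom of the white box.\<close>
    also have "\<dots> = (\<Sum>X\<in>Pow (A - B). split_weight t x y A (C0 \<union> X) * ?L (C0 \<union> X))"
    proof (rule sum.reindex_bij_witness[where i = "\<lambda>X. C0 \<union> X" and j = "\<lambda>W. W - C0"])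
      fix W assume "W \<in> {W \<in> Pow A. cond W}"
      then have "C0 \<subseteq> W" "W - C0 \<subseteq> A - B" unfolding EB by (auto simp: cond_def C0_def)
      then show "C0 \<union> (W - C0) = W" "W - C0 \<in> Pow (A - B)"
        "split_weight t x y A (C0 \<union> (W - C0)) * ?L (C0 \<union> (W - C0)) = split_weight t x y A W * ?L W"
        by (auto simp: Un_absorb1)
    next
      fix X assume "X \<in> Pow (A - B)"
      then show "C0 \<union> X - C0 = X" "C0 \<union> X \<in> {W \<in> Pow A. cond W}"
        unfolding EB using valid by (auto simp: cond_def C0_def)
    qed
    also have "\<dots> = (\<Sum>X\<in>Pow (A - B). (split_weight t x y A (C0 \<union> X) * t ^ inv_pairs B (T \<union> X)))
                     * (qpoch t x y (card B) * FR {} B)"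
      unfolding sum_distrib_right
    proof (rule sum.cong)
      fix X assume X: "X \<in> Pow (A - B)"
      have "cond (C0 \<union> X)" "C0 \<union> X \<in> Pow A" using X valid unfolding EB by (auto simp: cond_def C0_def)
      moreover have "K - (A - (C0 \<union> X)) = T \<union> X"
        using X valid unfolding EB by (auto simp: C0_def T_def)
      moreover have "aft (C0 \<union> X) = B"
        using X valid unfolding EB unfolding aft_def B_def by (auto simp: C0_def C1_def)
      ultimately show "split_weight t x y A (C0 \<union> X) * ?L (C0 \<union> X) =
          split_weight t x y A (C0 \<union> X) * t ^ inv_pairs B (T \<union> X) * (qpoch t x y (card B) * FR {} B)"
        by (simp add: L)
    qed simp
    also have "(\<Sum>X\<in>Pow (A - B). (split_weight t x y A (C0 \<union> X) * t ^ inv_pairs B (T \<union> X))) =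
        q * (\<Prod>c\<in>A - B. y + x * t ^ e c)"
    proof (rule split)
      fix Z assume Z: "Z \<subseteq> A - B"
      have fZ: "finite Z" using Z fin by (auto intro: finite_subset)
      have 1: "card (C0 \<union> Z) = card C0 + card Z"
        using Z fZ fin' unfolding EB by (intro card_Un_disjoint) (auto simp: C0_def)
      have "A - (C0 \<union> Z) = C1 \<union> (A - B - Z)" using Z valid unfolding EB by (auto simp: C0_def C1_def)
      then have 2: "card (A - (C0 \<union> Z)) = card C1 + card (A - B - Z)"
        using Z fZ fin fin' unfolding EB by (simp only:, intro card_Un_disjoint) (auto simp: C1_def)
      have 3: "inv_pairs (C0 \<union> Z) A = inv_pairs C0 A + inv_pairs Z A"
        using Z fZ fin fin' unfolding EB by (intro inv_pairs_Un_left) (auto simp: C0_def)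
      have 4: "inv_pairs B (T \<union> Z) = inv_pairs B T + inv_pairs B Z"
        using Z fZ fin fin' unfolding EB by (intro inv_pairs_Un_right) (auto simp: T_def)
      show "split_weight t x y A (C0 \<union> Z) * t ^ inv_pairs B (T \<union> Z) =
         q * (x ^ card Z * t ^ (inv_pairs Z A + inv_pairs B Z)) * y ^ card (A - B - Z)"
        by (simp add: split_weight_def q_def 1 2 3 4 power_add mult_ac)
    qed (use fin in auto)
    finally have left: "(\<Sum>W\<in>Pow A. split_weight t x y A W * ?L W) =
      q * (qpoch t x y (card B) * (\<Prod>c\<in>A - B. y + x * t ^ e c)) * FR {} B" by (simp add: mult_ac)
    \<comment> \<open>In the other order the choice is that of \<open>B - A\<close>, and it concerns
      the outgoing row: \<open>Y\<close> leaves through the white one, \<open>B - A - Y\<close>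
      through the purple one.\<close>
    have "sum rt S = (\<Sum>Y\<in>Pow (B - A). rt (C1 \<union> (B - A - Y)))"
    proof (rule sum.reindex_bij_witness[where i = "\<lambda>Y. C1 \<union> (B - A - Y)" and j = "\<lambda>P'. B - A - P'"])
      fix P' assume "P' \<in> S"
      then have "C1 \<union> (B - A - (B - A - P')) = P'" unfolding SB by (auto simp: S_def C1_def)
      then show "C1 \<union> (B - A - (B - A - P')) = P'" "B - A - P' \<in> Pow (B - A)"
        "rt (C1 \<union> (B - A - (B - A - P'))) = rt P'" by auto
    next
      fix Y assume "Y \<in> Pow (B - A)"
      then show "B - A - (C1 \<union> (B - A - Y)) = Y" "C1 \<union> (B - A - Y) \<in> S"
        unfolding SB using valid by (auto simp: C1_def S_def)
    qed
    also have "\<dots> = (\<Sum>Y\<in>Pow (B - A). (q * (x ^ card Y * t ^ (inv_pairs Y A + inv_pairs B Y)) * y ^ card (B - A - Y)))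
         * FR {} B"
      unfolding sum_distrib_right
    proof (rule sum.cong)
      fix Y assume "Y \<in> Pow (B - A)"
      then have Y: "Y \<subseteq> I - K - A" by (simp add: SB)
      have fY: "finite Y" using Y fin by (auto intro: finite_subset)
      define P' where "P' = C1 \<union> (B - A - Y)"
      have fP: "finite P'" using fin' by (auto simp: P'_def)
      have IP: "I - P' = T \<union> Y" using Y valid unfolding P'_def SB by (auto simp: C1_def T_def)
      have W: "A \<union> (T \<union> Y) - K = C0 \<union> Y" using Y valid by (auto simp: C0_def T_def)
      have PB: "(C0 \<union> Y) \<union> P' = B" "(C0 \<union> Y) \<inter> P' = {}"
        using Y unfolding P'_def SB by (auto simp: B_def C0_def C1_def)
      have FR: "FR (C0 \<union> Y) P' = FR {} B"
        using FR1[of "C0 \<union> Y" P'] PB BU by auto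
      have 1: "card (C0 \<union> Y) = card C0 + card Y"
        using Y fY fin' by (intro card_Un_disjoint) (auto simp: C0_def)
      have 2: "card P' = card C1 + card (B - A - Y)"
        unfolding P'_def using Y fY fin fin' by (intro card_Un_disjoint) (auto simp: C1_def)
      have 3: "inv_pairs (C0 \<union> Y) A = inv_pairs C0 A + inv_pairs Y A"
        using Y fY fin fin' by (intro inv_pairs_Un_left) (auto simp: C0_def)
      have 4: "inv_pairs B (T \<union> Y) = inv_pairs B T + inv_pairs B Y"
        using Y fY fin fin' by (intro inv_pairs_Un_right) (auto simp: T_def)
      \<comment> \<open>The two outgoing sets partition \<open>B\<close>, so their separate
        exponents against \<open>T \<union> Y\<close> merge into one that no longer refers to the
        rows.\<close>
      have 5: "inv_pairs B (T \<union> Y) = inv_pairs (C0 \<union> Y) (T \<union> Y) + inv_pairs P' (T \<union> Y)"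
        using PB fY fin fin' fP by (subst inv_pairs_Un_left[symmetric]) auto
      have 6: "inv_pairs (C0 \<union> Y) (A \<union> (T \<union> Y)) = inv_pairs (C0 \<union> Y) A + inv_pairs (C0 \<union> Y) (T \<union> Y)"
        using Y fY fin fin' by (intro inv_pairs_Un_right) (auto simp: T_def)
      have "rt P' = y ^ card P' * x ^ card (C0 \<union> Y)
         * t ^ (inv_pairs P' (T \<union> Y) + inv_pairs (C0 \<union> Y) (A \<union> (T \<union> Y))) * FR {} B"
        unfolding rt_def IP W FR by (simp add: power_add mult_ac)
      also have "inv_pairs P' (T \<union> Y) + inv_pairs (C0 \<union> Y) (A \<union> (T \<union> Y)) =
          inv_pairs C0 A + inv_pairs Y A + (inv_pairs B T + inv_pairs B Y)"
        using 3 4 5 6 by linarith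
      finally show "rt (C1 \<union> (B - A - Y)) =
         q * (x ^ card Y * t ^ (inv_pairs Y A + inv_pairs B Y)) * y ^ card (B - A - Y) * FR {} B"
        unfolding P'_def[symmetric] by (simp add: 1 2 q_def power_add mult_ac)
    qed simp
    also have "(\<Sum>Y\<in>Pow (B - A). (q * (x ^ card Y * t ^ (inv_pairs Y A + inv_pairs B Y)) * y ^ card (B - A - Y))) =
        q * (\<Prod>c\<in>B - A. y + x * t ^ e c)"
      by (rule split) (use fin' in auto)
    finally have right: "sum rt S = q * (\<Prod>c\<in>B - A. y + x * t ^ e c) * FR {} B" .
    show ?thesis
      unfolding R left right using qpoch_telescope[OF fin(1) fin'(1), of t x y]
      by (simp add: e_def mult_ac)
  qed
qed

section \<open>Commutation of white and purple rows\<close>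

definition colour_label :: "nat \<Rightarrow> nat set \<Rightarrow> label" where
  "colour_label k S = (\<lambda>a\<in>{1..k}. of_bool (a \<in> S))"

lemma colour_label_bij: "bij_betw (colour_label k) (Pow {1..k}) (labels k)"
proof (rule bij_betw_byWitness[where f' = "\<lambda>I. {a\<in>{1..k}. I a = 1}"])
  show "\<forall>S\<in>Pow {1..k}. {a \<in> {1..k}. colour_label k S a = 1} = S"
    by (auto simp: colour_label_def)
  show "\<forall>I\<in>labels k. colour_label k {a \<in> {1..k}. I a = 1} = I"
  proof
    fix I assume I: "I \<in> labels k"
    show "colour_label k {a \<in> {1..k}. I a = 1} = I"
    proof
      fix a show "colour_label k {a \<in> {1..k}. I a = 1} a = I a"
        using I by (cases "a \<in> {1..k}") (auto simp: colour_label_def labels_def PiE_iff extensional_def)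
    qed
  qed
  show "colour_label k ` Pow {1..k} \<subseteq> labels k"
    by (auto simp: colour_label_def labels_def split: if_splits)
qed auto

lemma sum_labels: "sum f (labels k) = (\<Sum>S\<in>Pow {1..k}. f (colour_label k S))"
  using sum.reindex_bij_betw[OF colour_label_bij, of f k] by simp

lemma finite_labels [simp]: "finite (labels k)"
  using bij_betw_finite[OF colour_label_bij] by simp

lemma colour_label_in_labels [simp]: "colour_label k S \<in> labels k"
  by (auto simp: colour_label_def labels_def split: if_splits)

lemma obtain_colours:
  assumes "I \<in> labels k"
  obtains S where "S \<subseteq> {1..k}" "I = colour_label k S"
  using assms colour_label_bij[of k] by (auto simp: bij_betw_def)

lemma colour_label_eq_iff:
  "A \<subseteq> {1..k} \<Longrightarrow> B \<subseteq> {1..k} \<Longrightarrow> colour_label k A = colour_label k B \<longleftrightarrow> A = B"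
  using inj_on_eq_iff[OF bij_betw_imp_inj_on[OF colour_label_bij], of A k B] by simp

lemma colour_label_empty [simp]: "colour_label k {} = empty_label k"
  by (simp add: colour_label_def empty_label_def)

lemma empty_label_in_labels [simp]: "empty_label k \<in> labels k"
  using colour_label_in_labels[of k "{}"] by simp

lemma phi_cong:
  assumes "\<And>c. c \<in> {1..k} \<Longrightarrow> I c = I' c" "\<And>c. c \<in> {1..k} \<Longrightarrow> J c = J' c"
  shows "phi k I J = phi k I' J'"
  unfolding phi_def by (rule sum.cong) (use assms in auto)

lemma phi_colour_label:
  assumes "A \<subseteq> {1..k}" "B \<subseteq> {1..k}"
  shows "phi k (colour_label k A) (\<lambda>c. of_bool (c \<in> B)) = int (inv_pairs A B)"
proof -
  have fin: "finite {(c, d). 1 \<le> c \<and> c < d \<and> d \<le> k}"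
    by (rule finite_subset[of _ "{1..k} \<times> {1..k}"]) auto
  have "phi k (colour_label k A) (\<lambda>c. of_bool (c \<in> B)) =
      (\<Sum>p\<in>{(c, d). 1 \<le> c \<and> c < d \<and> d \<le> k}. of_bool (p \<in> {(c, d). c \<in> A \<and> d \<in> B \<and> c < d}))"
    unfolding phi_def by (rule sum.cong) (auto simp: colour_label_def)
  also have "\<dots> = int (card ({(c, d). 1 \<le> c \<and> c < d \<and> d \<le> k} \<inter> {(c, d). c \<in> A \<and> d \<in> B \<and> c < d}))"
    using fin by (simp add: sum.If_cases of_bool_def)
  also have "{(c, d). 1 \<le> c \<and> c < d \<and> d \<le> k} \<inter> {(c, d). c \<in> A \<and> d \<in> B \<and> c < d} =
      {(c, d). c \<in> A \<and> d \<in> B \<and> c < d}" using assms by auto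
  finally show ?thesis by (simp add: inv_pairs_def)
qed

lemma label_size_colour_label:
  assumes "A \<subseteq> {1..k}" shows "label_size k (colour_label k A) = int (card A)"
proof -
  have "label_size k (colour_label k A) = (\<Sum>c\<in>{1..k}. of_bool (c \<in> A))"
    unfolding label_size_def by (rule sum.cong) (auto simp: colour_label_def)
  also have "\<dots> = int (card ({1..k} \<inter> A))" by (simp add: sum.If_cases of_bool_def)
  finally show ?thesis using assms by (simp add: Int_absorb1)
qed

lemma prod_of_bool: "finite A \<Longrightarrow> (\<Prod>c\<in>A. of_bool (Q c)) = (of_bool (\<forall>c\<in>A. Q c) :: 'a::field)"
  by (induction A rule: finite_induct) auto

lemma white_weight_alt:
  "white_weight k t x I J K L = (if (\<forall>c\<in>{1..k}. I c + J c = K c + L c \<and> I c + J c \<noteq> 2)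
     then x powi label_size k L * t powi phi k L (\<lambda>c. I c + J c) else 0)"
  unfolding white_weight_def prod_of_bool[OF finite_atLeastAtMost] by auto

lemma purple_weight_alt:
  "purple_weight k t x I J K L = (if (\<forall>c\<in>{1..k}. I c + J c = K c + L c \<and> K c \<ge> J c)
     then x powi label_size k L * t powi phi k L (\<lambda>c. K c - J c) else 0)"
  unfolding purple_weight_def prod_of_bool[OF finite_atLeastAtMost] by auto

lemma white_weight_colours:
  assumes "I \<subseteq> {1..k}" "J \<subseteq> {1..k}" "K \<subseteq> {1..k}" "L \<subseteq> {1..k}"
  shows "white_weight k t x (colour_label k I) (colour_label k J) (colour_label k K) (colour_label k L)
       = white_set t x I J K L"
proof -
  have "(\<forall>c\<in>{1..k}. colour_label k I c + colour_label k J c = colour_label k K c + colour_label k L c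
          \<and> colour_label k I c + colour_label k J c \<noteq> 2) \<longleftrightarrow>
        (\<forall>c\<in>{1..k}. (c \<in> I \<longrightarrow> c \<notin> J) \<and> (c \<in> K \<longrightarrow> c \<notin> L) \<and> (c \<in> I \<or> c \<in> J \<longleftrightarrow> c \<in> K \<or> c \<in> L))"
    by (rule ball_cong) (auto simp: colour_label_def)
  also have "\<dots> \<longleftrightarrow> I \<inter> J = {} \<and> K \<inter> L = {} \<and> I \<union> J = K \<union> L" using assms by blast
  finally have c: "(\<forall>c\<in>{1..k}. colour_label k I c + colour_label k J c = colour_label k K c + colour_label k L c
          \<and> colour_label k I c + colour_label k J c \<noteq> 2) \<longleftrightarrow> I \<inter> J = {} \<and> K \<inter> L = {} \<and> I \<union> J = K \<union> L" .
  have "phi k (colour_label k L) (\<lambda>c. colour_label k I c + colour_label k J c) = int (inv_pairs L (I \<union> J))"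
    if "I \<inter> J = {}"
    unfolding phi_colour_label[symmetric, OF assms(4) Un_least[OF assms(1,2)]]
    by (rule phi_cong) (use that in \<open>auto simp: colour_label_def\<close>)
  then show ?thesis
    unfolding white_weight_alt white_set_def c label_size_colour_label[OF assms(4)] by auto
qed

lemma purple_weight_colours:
  assumes "I \<subseteq> {1..k}" "J \<subseteq> {1..k}" "K \<subseteq> {1..k}" "L \<subseteq> {1..k}"
  shows "purple_weight k t x (colour_label k I) (colour_label k J) (colour_label k K) (colour_label k L)
       = purple_set t x I J K L"
proof -
  have "(\<forall>c\<in>{1..k}. colour_label k I c + colour_label k J c = colour_label k K c + colour_label k L c
          \<and> colour_label k K c \<ge> colour_label k J c) \<longleftrightarrow>
        (\<forall>c\<in>{1..k}. (c \<in> J \<longrightarrow> c \<in> K) \<and> (c \<in> L \<longrightarrow> c \<in> I) \<and> (c \<in> I \<and> c \<notin> L \<longleftrightarrow> c \<in> K \<and> c \<notin> J))"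
    by (rule ball_cong) (auto simp: colour_label_def)
  also have "\<dots> \<longleftrightarrow> J \<subseteq> K \<and> L \<subseteq> I \<and> I - L = K - J" using assms by blast
  finally have c: "(\<forall>c\<in>{1..k}. colour_label k I c + colour_label k J c = colour_label k K c + colour_label k L c
          \<and> colour_label k K c \<ge> colour_label k J c) \<longleftrightarrow> J \<subseteq> K \<and> L \<subseteq> I \<and> I - L = K - J" .
  have "phi k (colour_label k L) (\<lambda>c. colour_label k K c - colour_label k J c) = int (inv_pairs L (K - J))"
    if "J \<subseteq> K"
    unfolding phi_colour_label[symmetric, OF assms(4) order_trans[OF Diff_subset assms(3)]]
    by (rule phi_cong) (use that in \<open>auto simp: colour_label_def\<close>)
  then show ?thesis
    unfolding purple_weight_alt purple_set_def c label_size_colour_label[OF assms(4)] by auto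
qed

section \<open>Rows and pairs of rows as matrix entries\<close>

type_synonym 'a vertex = "label \<Rightarrow> label \<Rightarrow> label \<Rightarrow> label \<Rightarrow> 'a"

text \<open>The inner horizontal edges are summed out from left to right. The outer ones remain
  arguments because the inductions cut rows open.\<close>

fun row :: "nat \<Rightarrow> 'a::field vertex \<Rightarrow> label \<Rightarrow> label list \<Rightarrow> label list \<Rightarrow> label \<Rightarrow> 'a" where
  "row k w J [] [] J' = of_bool (J = J')"
| "row k w J (b # bs) (t # ts) J' = (\<Sum>L\<in>labels k. w b J t L * row k w L bs ts J')"
| "row k w J _ _ J' = 0"

definition states :: "nat \<Rightarrow> nat \<Rightarrow> label list set" where
  "states k n = {bs. length bs = n \<and> set bs \<subseteq> labels k}"

lemma states_0 [simp]: "states k 0 = {[]}"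
  by (auto simp: states_def)

lemma states_Suc: "states k (Suc n) = (\<lambda>(b, bs). b # bs) ` (labels k \<times> states k n)"
  by (auto simp: states_def image_iff length_Suc_conv)

lemma finite_states [simp]: "finite (states k n)"
  by (induction n) (auto simp: states_Suc)

lemma sum_states_Suc: "sum f (states k (Suc n)) = (\<Sum>b\<in>labels k. \<Sum>bs\<in>states k n. f (b # bs))"
  unfolding states_Suc
  by (subst sum.reindex) (auto simp: inj_on_def sum.cartesian_product case_prod_unfold)

text \<open>The first vertex function belongs to the lower row. Left edges are arbitrary and right
  edges empty, as the induction over columns strips them off from the left.\<close>

definition two_rows :: "nat \<Rightarrow> 'a::field vertex \<Rightarrow> 'a vertex \<Rightarrow> label \<Rightarrow> label \<Rightarrow> label list \<Rightarrow> label list \<Rightarrow> 'a" where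
  "two_rows k v w J1 J2 bs ts =
    (\<Sum>ms\<in>states k (length bs). row k v J1 bs ms (empty_label k) * row k w J2 ms ts (empty_label k))"

lemma two_rows_Nil: "two_rows k v w J1 J2 [] [] = of_bool (J1 = empty_label k \<and> J2 = empty_label k)"
  by (simp add: two_rows_def)

lemma two_rows_Cons:
  "two_rows k v w J1 J2 (b # bs) (t # ts) =
    (\<Sum>M\<in>labels k. \<Sum>L1\<in>labels k. \<Sum>L2\<in>labels k. v b J1 M L1 * w M J2 t L2 * two_rows k v w L1 L2 bs ts)"
proof -
  let ?e = "empty_label k"
  have "two_rows k v w J1 J2 (b # bs) (t # ts) =
     (\<Sum>M\<in>labels k. \<Sum>ms\<in>states k (length bs). \<Sum>L1\<in>labels k. \<Sum>L2\<in>labels k.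
        v b J1 M L1 * w M J2 t L2 * (row k v L1 bs ms ?e * row k w L2 ms ts ?e))"
    by (simp add: two_rows_def sum_states_Suc sum_product mult_ac)
  also have "\<dots> = (\<Sum>M\<in>labels k. \<Sum>L1\<in>labels k. \<Sum>L2\<in>labels k. \<Sum>ms\<in>states k (length bs).
        v b J1 M L1 * w M J2 t L2 * (row k v L1 bs ms ?e * row k w L2 ms ts ?e))"
    by (intro sum.cong refl) (subst sum.swap, intro sum.cong refl, subst sum.swap, rule refl)
  finally show ?thesis by (simp add: two_rows_def sum_distrib_left)
qed

text \<open>Both conjuncts for the columns further right are the hypotheses of
  \<open>column_exchange\<close>, which carries the second one across one more column; the first is
  visible from \<open>purple_white_column\<close>. In \<open>FL\<close> and in \<open>FR\<close> the
  white label comes first, although the rows are stacked in opposite order.\<close>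

lemma two_rows_exchange:
  fixes t x y :: "'a::field"
  assumes "bs \<in> states k n" "ts \<in> states k n"
  defines "FL \<equiv> \<lambda>bs ts W P. two_rows k (white_weight k t x) (purple_weight k t y) (colour_label k W) (colour_label k P) bs ts"
    and "FR \<equiv> \<lambda>bs ts W P. two_rows k (purple_weight k t y) (white_weight k t x) (colour_label k P) (colour_label k W) bs ts"
  shows "(\<forall>W P. W \<subseteq> {1..k} \<longrightarrow> P \<subseteq> {1..k} \<longrightarrow>
             FR bs ts W P = (if W \<inter> P = {} then FR bs ts {} (W \<union> P) else 0)) \<and>
         (\<forall>A. A \<subseteq> {1..k} \<longrightarrow>
             (\<Sum>W\<in>Pow A. split_weight t x y A W * FL bs ts W (A - W)) = qpoch t x y (card A) * FR bs ts {} A)"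
  using assms(1,2)
proof (induction n arbitrary: bs ts)
  case 0
  then have nil: "bs = []" "ts = []" by auto
  have emp: "colour_label k S = empty_label k \<longleftrightarrow> S = {}" if "S \<subseteq> {1..k}" for S
    using colour_label_eq_iff[OF that, of "{}"] by simp
  have FR: "FR bs ts W P = of_bool (W = {} \<and> P = {})" if "W \<subseteq> {1..k}" "P \<subseteq> {1..k}" for W P
    using that by (auto simp: nil FR_def two_rows_Nil emp)
  have FL: "FL bs ts W P = of_bool (W = {} \<and> P = {})" if "W \<subseteq> {1..k}" "P \<subseteq> {1..k}" for W P
    using that by (auto simp: nil FL_def two_rows_Nil emp)
  show ?case
  proof (intro conjI allI impI)
    fix W P assume "W \<subseteq> {1..k}" "P \<subseteq> {1..k}"
    then show "FR bs ts W P = (if W \<inter> P = {} then FR bs ts {} (W \<union> P) else 0)"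
      using FR[of W P] FR[of "{}" "W \<union> P"] by auto
  next
    fix A assume A: "A \<subseteq> {1..k}"
    have "(\<Sum>W\<in>Pow A. split_weight t x y A W * FL bs ts W (A - W)) =
          (\<Sum>W\<in>Pow A. split_weight t x y A W * of_bool (W = {} \<and> A - W = {}))"
    proof (rule sum.cong)
      fix W assume "W \<in> Pow A"
      then have "FL bs ts W (A - W) = of_bool (W = {} \<and> A - W = {})"
        using A by (intro FL) auto
      then show "split_weight t x y A W * FL bs ts W (A - W) =
          split_weight t x y A W * of_bool (W = {} \<and> A - W = {})" by simp
    qed simp
    also have "\<dots> = of_bool (A = {})"
      by (cases "A = {}") (auto simp: split_weight_def intro!: sum.neutral)
    finally show "(\<Sum>W\<in>Pow A. split_weight t x y A W * FL bs ts W (A - W)) =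
         qpoch t x y (card A) * FR bs ts {} A"
      using A by (auto simp: FR qpoch_def)
  qed
next
  case (Suc n)
  obtain I bs' where bs: "bs = colour_label k I # bs'" "I \<subseteq> {1..k}" "bs' \<in> states k n"
    using Suc.prems(1) by (auto simp: states_Suc elim: obtain_colours)
  obtain K ts' where ts: "ts = colour_label k K # ts'" "K \<subseteq> {1..k}" "ts' \<in> states k n"
    using Suc.prems(2) by (auto simp: states_Suc elim: obtain_colours)
  note IH = Suc.IH[OF bs(3) ts(3)]
  let ?U = "{1..k}"
  have FL: "FL bs ts W P = (\<Sum>M\<in>Pow ?U. \<Sum>W'\<in>Pow ?U. \<Sum>P'\<in>Pow ?U.
      white_set t x I W M W' * purple_set t y M P K P' * FL bs' ts' W' P')"
    if "W \<subseteq> {1..k}" "P \<subseteq> {1..k}" for W P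
    unfolding FL_def bs ts two_rows_Cons sum_labels using that bs ts
    by (intro sum.cong refl) (simp add: white_weight_colours purple_weight_colours)
  have FR: "FR bs ts W P = (\<Sum>M\<in>Pow ?U. \<Sum>P'\<in>Pow ?U. \<Sum>W'\<in>Pow ?U.
      purple_set t y I P M P' * white_set t x M W K W' * FR bs' ts' W' P')"
    if "W \<subseteq> {1..k}" "P \<subseteq> {1..k}" for W P
    unfolding FR_def bs ts two_rows_Cons sum_labels using that bs ts
    by (intro sum.cong refl) (simp add: white_weight_colours purple_weight_colours)
  show ?case
  proof (intro conjI allI impI)
    fix W P assume WP: "W \<subseteq> {1..k}" "P \<subseteq> {1..k}"
    show "FR bs ts W P = (if W \<inter> P = {} then FR bs ts {} (W \<union> P) else 0)"
      unfolding FR[OF WP] FR[OF empty_subsetI Un_least[OF WP]]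
        purple_white_column[OF finite_atLeastAtMost bs(2) WP]
        purple_white_column[OF finite_atLeastAtMost bs(2) empty_subsetI Un_least[OF WP]]
      by simp
  next
    fix A assume A: "A \<subseteq> {1..k}"
    have "(\<Sum>W\<in>Pow A. split_weight t x y A W * FL bs ts W (A - W)) =
       (\<Sum>W\<in>Pow A. split_weight t x y A W *
            (\<Sum>M\<in>Pow ?U. \<Sum>W'\<in>Pow ?U. \<Sum>P'\<in>Pow ?U.
               white_set t x I W M W' * purple_set t y M (A - W) K P' * FL bs' ts' W' P'))"
    proof (rule sum.cong)
      fix W assume "W \<in> Pow A"
      then have "W \<subseteq> {1..k}" "A - W \<subseteq> {1..k}" using A by auto
      then show "split_weight t x y A W * FL bs ts W (A - W) = split_weight t x y A W *
            (\<Sum>M\<in>Pow ?U. \<Sum>W'\<in>Pow ?U. \<Sum>P'\<in>Pow ?U.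
               white_set t x I W M W' * purple_set t y M (A - W) K P' * FL bs' ts' W' P')"
        by (simp only: FL)
    qed simp
    also have "\<dots> = qpoch t x y (card A) * FR bs ts {} A"
      unfolding FR[OF empty_subsetI A]
    proof (rule column_exchange[OF finite_atLeastAtMost A bs(2) ts(2)])
      fix W P assume "W \<subseteq> {1..k}" "P \<subseteq> {1..k}"
      then have *: "FR bs' ts' W P = (if W \<inter> P = {} then FR bs' ts' {} (W \<union> P) else 0)"
        using IH by blast
      show "FR bs' ts' W P = 0" if "W \<inter> P \<noteq> {}" using * that by presburger
      show "FR bs' ts' W P = FR bs' ts' {} (W \<union> P)" if "W \<inter> P = {}" using * that by presburger
    next
      fix B assume "B \<subseteq> {1..k}"
      then show "(\<Sum>W\<in>Pow B. split_weight t x y B W * FL bs' ts' W (B - W)) =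
          qpoch t x y (card B) * FR bs' ts' {} B" using IH by blast
    qed
    finally show "(\<Sum>W\<in>Pow A. split_weight t x y A W * FL bs ts W (A - W)) =
       qpoch t x y (card A) * FR bs ts {} A" .
  qed
qed

text \<open>The instance \<open>A = {}\<close>, where \<open>split_weight\<close> and
  \<open>qpoch\<close> are both 1.\<close>

lemma white_purple_commute:
  assumes "bs \<in> states k n" "ts \<in> states k n"
  shows "two_rows k (white_weight k t x) (purple_weight k t y) (empty_label k) (empty_label k) bs ts =
         two_rows k (purple_weight k t y) (white_weight k t x) (empty_label k) (empty_label k) bs ts"
  using conjunct2[OF two_rows_exchange[OF assms, of t y x], rule_format, of "{}"]
  by (simp add: split_weight_def qpoch_def)

section \<open>Particles and holes\<close>

text \<open>For horizontal edges: their particles stay particles and only the colours are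
  reversed.\<close>

definition flip_label :: "nat \<Rightarrow> label \<Rightarrow> label" where
  "flip_label k I = (\<lambda>a\<in>{1..k}. I (k + 1 - a))"

text \<open>Together with a reflection of the columns, this is conjugation of the tuple of partitions.\<close>

definition hole_label :: "nat \<Rightarrow> label \<Rightarrow> label" where
  "hole_label k I = (\<lambda>a\<in>{1..k}. 1 - I (k + 1 - a))"

lemma labels_iff: "I \<in> labels k \<longleftrightarrow> (\<forall>a\<in>{1..k}. I a = 0 \<or> I a = 1) \<and> (\<forall>a. a \<notin> {1..k} \<longrightarrow> I a = undefined)"
  by (auto simp: labels_def PiE_iff extensional_def)

lemma label_reverse_value:
  assumes "I \<in> labels k" "a \<in> {1..k}" shows "I (k + 1 - a) \<in> {0, 1}"
proof -
  have "k + 1 - a \<in> {1..k}" using assms(2) by auto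
  then show ?thesis using assms(1) unfolding labels_def by (rule PiE_mem[rotated])
qed

lemma flip_label_in_labels [simp]:
  assumes "I \<in> labels k" shows "flip_label k I \<in> labels k"
  using label_reverse_value[OF assms] by (simp add: labels_def flip_label_def restrict_PiE_iff)

lemma hole_label_in_labels [simp]:
  assumes "I \<in> labels k" shows "hole_label k I \<in> labels k"
proof -
  have "1 - I (k + 1 - a) \<in> {0, 1}" if "a \<in> {1..k}" for a
    using label_reverse_value[OF assms that] by auto
  then show ?thesis by (simp add: labels_def hole_label_def restrict_PiE_iff)
qed

lemma flip_label_flip_label [simp]: "I \<in> labels k \<Longrightarrow> flip_label k (flip_label k I) = I"
  by (auto simp: labels_iff flip_label_def fun_eq_iff)

lemma hole_label_hole_label [simp]: "I \<in> labels k \<Longrightarrow> hole_label k (hole_label k I) = I"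
  by (auto simp: labels_iff hole_label_def fun_eq_iff)

lemma flip_label_empty_label [simp]: "flip_label k (empty_label k) = empty_label k"
  by (auto simp: empty_label_def flip_label_def fun_eq_iff)

lemma label_size_empty_label [simp]: "label_size k (empty_label k) = 0"
  by (simp add: label_size_def empty_label_def)

lemma sum_labels_flip: "(\<Sum>L\<in>labels k. f (flip_label k L)) = sum f (labels k)"
  by (rule sum.reindex_bij_witness[where i = "flip_label k" and j = "flip_label k"]) auto

lemma label_size_flip [simp]: "label_size k (flip_label k I) = label_size k I"
  unfolding label_size_def
  by (rule sum.reindex_bij_witness[where i = "\<lambda>a. k + 1 - a" and j = "\<lambda>a. k + 1 - a"])
     (auto simp: flip_label_def)

text \<open>Reversal turns c < d around. This compensates for the exchange of left and right edges
  under reflection.\<close>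

lemma phi_reverse: "phi k (\<lambda>a. I (k + 1 - a)) (\<lambda>a. J (k + 1 - a)) = phi k J I"
  unfolding phi_def
  by (rule sum.reindex_bij_witness[where i = "\<lambda>(c, d). (k + 1 - d, k + 1 - c)"
        and j = "\<lambda>(c, d). (k + 1 - d, k + 1 - c)"]) auto

lemma phi_add_left: "phi k (\<lambda>c. I c + I' c) J = phi k I J + phi k I' J"
  by (simp add: phi_def sum.distrib[symmetric] case_prod_unfold algebra_simps)

lemma phi_add_right: "phi k I (\<lambda>c. J c + J' c) = phi k I J + phi k I J'"
  by (simp add: phi_def sum.distrib[symmetric] case_prod_unfold algebra_simps)

lemma phi_diff_left: "phi k (\<lambda>c. I c - I' c) J = phi k I J - phi k I' J"
  by (simp add: phi_def sum_subtractf[symmetric] case_prod_unfold algebra_simps)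

lemma phi_diff_right: "phi k I (\<lambda>c. J c - J' c) = phi k I J - phi k I J'"
  by (simp add: phi_def sum_subtractf[symmetric] case_prod_unfold algebra_simps)

lemmas phi_linear = phi_add_left phi_add_right phi_diff_left phi_diff_right

definition conserved :: "nat \<Rightarrow> label \<Rightarrow> label \<Rightarrow> label \<Rightarrow> label \<Rightarrow> bool" where
  "conserved k I J K L \<longleftrightarrow> (\<forall>c\<in>{1..k}. I c + J c = K c + L c)"

lemma colours_reverse: "(\<forall>c\<in>{1..k}. Q (k + 1 - c)) \<longleftrightarrow> (\<forall>c\<in>{1..k}. Q c)" for k :: nat
proof -
  have "(\<lambda>c. k + 1 - c) ` {1..k} = {1..k}"
  proof (intro equalityI subsetI)
    fix c assume "c \<in> {1..k}"
    then have "c = k + 1 - (k + 1 - c)" "k + 1 - c \<in> {1..k}" by auto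
    then show "c \<in> (\<lambda>c. k + 1 - c) ` {1..k}" by (rule image_eqI)
  qed auto
  then show ?thesis using ball_simps(9)[of "\<lambda>c. k + 1 - c" "{1..k}" Q] by simp
qed

lemma conserved_holes:
  "conserved k (hole_label k I) (flip_label k L) (hole_label k K) (flip_label k J) \<longleftrightarrow> conserved k I J K L"
proof -
  have "conserved k (hole_label k I) (flip_label k L) (hole_label k K) (flip_label k J) \<longleftrightarrow>
     (\<forall>c\<in>{1..k}. 1 - I (k + 1 - c) + L (k + 1 - c) = 1 - K (k + 1 - c) + J (k + 1 - c))"
    unfolding conserved_def by (rule ball_cong) (auto simp: hole_label_def flip_label_def)
  also have "\<dots> \<longleftrightarrow> (\<forall>c\<in>{1..k}. 1 - I c + L c = 1 - K c + J c)"
    by (rule colours_reverse[where Q = "\<lambda>c. 1 - I c + L c = 1 - K c + J c"])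
  also have "\<dots> \<longleftrightarrow> conserved k I J K L" unfolding conserved_def by (rule ball_cong) auto
  finally show ?thesis .
qed

lemma white_conserved: "white_weight k t x I J K L \<noteq> 0 \<Longrightarrow> conserved k I J K L"
  by (auto simp: white_weight_alt conserved_def split: if_splits)

lemma purple_conserved: "purple_weight k t x I J K L \<noteq> 0 \<Longrightarrow> conserved k I J K L"
  by (auto simp: purple_weight_alt conserved_def split: if_splits)

text \<open>To be applied with \<open>b\<close> the exponent of the box in the hole picture and
  \<open>d\<close> the surplus.\<close>

lemma powi_inverse_shift:
  fixes t :: "'a::field"
  assumes "t \<noteq> 0" "a = d - b" shows "t powi a = t powi d * inverse t powi b"
  using assms by (simp add: power_int_diff power_int_inverse divide_inverse)

text \<open>By conservation, no colour is on both the bottom and the left edge iff none is on both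
  the top and the right edge, and this is the purple condition for holes. The hole box has exponent
  \<open>phi k (\<lambda>c. 1 - K c - L c) J\<close>; its part in \<open>L\<close> reproduces
  \<open>phi k L J\<close>, and the other terms are surplus.\<close>

lemma white_vertex_holes:
  fixes t x :: "'a::field"
  assumes "t \<noteq> 0" "I \<in> labels k" "J \<in> labels k" "K \<in> labels k" "L \<in> labels k"
  shows "x powi label_size k J * white_weight k t x I J K L =
    x powi label_size k L * t powi (phi k L I + phi k (\<lambda>c. 1 - K c) J) *
    purple_weight k (inverse t) x (hole_label k I) (flip_label k L) (hole_label k K) (flip_label k J)"
proof -
  have "(\<forall>c\<in>{1..k}. hole_label k I c + flip_label k L c = hole_label k K c + flip_label k J c
           \<and> hole_label k K c \<ge> flip_label k L c) \<longleftrightarrow>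
     (\<forall>c\<in>{1..k}. 1 - I (k + 1 - c) + L (k + 1 - c) = 1 - K (k + 1 - c) + J (k + 1 - c)
           \<and> 1 - K (k + 1 - c) \<ge> L (k + 1 - c))"
    by (rule ball_cong) (auto simp: hole_label_def flip_label_def)
  also have "\<dots> \<longleftrightarrow> (\<forall>c\<in>{1..k}. 1 - I c + L c = 1 - K c + J c \<and> 1 - K c \<ge> L c)"
    by (rule colours_reverse[where Q = "\<lambda>c. 1 - I c + L c = 1 - K c + J c \<and> 1 - K c \<ge> L c"])
  also have "\<dots> \<longleftrightarrow> (\<forall>c\<in>{1..k}. I c + J c = K c + L c \<and> I c + J c \<noteq> 2)"
  proof (rule ball_cong)
    fix c assume "c \<in> {1..k}"
    then have "I c \<in> {0,1}" "J c \<in> {0,1}" "K c \<in> {0,1}" "L c \<in> {0,1}"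
      using assms by (auto simp: labels_iff)
    then show "(1 - I c + L c = 1 - K c + J c \<and> 1 - K c \<ge> L c) \<longleftrightarrow> (I c + J c = K c + L c \<and> I c + J c \<noteq> 2)"
      by auto
  qed simp
  finally have c: "(\<forall>c\<in>{1..k}. hole_label k I c + flip_label k L c = hole_label k K c + flip_label k J c
           \<and> hole_label k K c \<ge> flip_label k L c) \<longleftrightarrow>
        (\<forall>c\<in>{1..k}. I c + J c = K c + L c \<and> I c + J c \<noteq> 2)" .
  have "phi k (flip_label k J) (\<lambda>c. hole_label k K c - flip_label k L c) =
     phi k (\<lambda>a. J (k + 1 - a)) (\<lambda>a. (\<lambda>c. 1 - K c - L c) (k + 1 - a))"
    by (rule phi_cong) (auto simp: flip_label_def hole_label_def)
  also have "\<dots> = phi k (\<lambda>c. 1 - K c - L c) J" by (rule phi_reverse)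
  finally have e: "phi k L (\<lambda>c. I c + J c) = phi k L I + phi k (\<lambda>c. 1 - K c) J
     - phi k (flip_label k J) (\<lambda>c. hole_label k K c - flip_label k L c)"
    by (simp add: phi_linear)
  show ?thesis
    unfolding purple_weight_alt white_weight_alt c powi_inverse_shift[OF assms(1) e]
    by (simp only: label_size_flip mult_ac mult_zero_left mult_zero_right split: if_split) blast
qed

text \<open>As for a white box; in the surplus the edges \<open>I\<close> and \<open>K\<close> have
  changed places.\<close>

lemma purple_vertex_holes:
  fixes t x :: "'a::field"
  assumes "t \<noteq> 0" "I \<in> labels k" "J \<in> labels k" "K \<in> labels k" "L \<in> labels k"
  shows "x powi label_size k J * purple_weight k t x I J K L =
    x powi label_size k L * t powi (phi k L K + phi k (\<lambda>c. 1 - I c) J) *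
    white_weight k (inverse t) x (hole_label k I) (flip_label k L) (hole_label k K) (flip_label k J)"
proof -
  have "(\<forall>c\<in>{1..k}. hole_label k I c + flip_label k L c = hole_label k K c + flip_label k J c
           \<and> hole_label k I c + flip_label k L c \<noteq> 2) \<longleftrightarrow>
     (\<forall>c\<in>{1..k}. 1 - I (k + 1 - c) + L (k + 1 - c) = 1 - K (k + 1 - c) + J (k + 1 - c)
           \<and> 1 - I (k + 1 - c) + L (k + 1 - c) \<noteq> 2)"
    by (rule ball_cong) (auto simp: hole_label_def flip_label_def)
  also have "\<dots> \<longleftrightarrow> (\<forall>c\<in>{1..k}. 1 - I c + L c = 1 - K c + J c \<and> 1 - I c + L c \<noteq> 2)"
    by (rule colours_reverse[where Q = "\<lambda>c. 1 - I c + L c = 1 - K c + J c \<and> 1 - I c + L c \<noteq> 2"])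
  also have "\<dots> \<longleftrightarrow> (\<forall>c\<in>{1..k}. I c + J c = K c + L c \<and> K c \<ge> J c)"
  proof (rule ball_cong)
    fix c assume "c \<in> {1..k}"
    then have "I c \<in> {0,1}" "J c \<in> {0,1}" "K c \<in> {0,1}" "L c \<in> {0,1}"
      using assms by (auto simp: labels_iff)
    then show "(1 - I c + L c = 1 - K c + J c \<and> 1 - I c + L c \<noteq> 2) \<longleftrightarrow> (I c + J c = K c + L c \<and> K c \<ge> J c)"
      by auto
  qed simp
  finally have c: "(\<forall>c\<in>{1..k}. hole_label k I c + flip_label k L c = hole_label k K c + flip_label k J c
           \<and> hole_label k I c + flip_label k L c \<noteq> 2) \<longleftrightarrow>
        (\<forall>c\<in>{1..k}. I c + J c = K c + L c \<and> K c \<ge> J c)" .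
  have "phi k (flip_label k J) (\<lambda>c. hole_label k I c + flip_label k L c) =
     phi k (\<lambda>a. J (k + 1 - a)) (\<lambda>a. (\<lambda>c. 1 - I c + L c) (k + 1 - a))"
    by (rule phi_cong) (auto simp: flip_label_def hole_label_def)
  also have "\<dots> = phi k (\<lambda>c. 1 - I c + L c) J" by (rule phi_reverse)
  finally have e: "phi k L (\<lambda>c. K c - J c) = phi k L K + phi k (\<lambda>c. 1 - I c) J
     - phi k (flip_label k J) (\<lambda>c. hole_label k I c + flip_label k L c)"
    by (simp add: phi_linear)
  show ?thesis
    unfolding purple_weight_alt white_weight_alt c powi_inverse_shift[OF assms(1) e]
    by (simp only: label_size_flip mult_ac mult_zero_left mult_zero_right split: if_split) blast
qed

section \<open>Telescoping of the surplus along a row\<close>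

definition colour_total :: "label list \<Rightarrow> label" where
  "colour_total bs c = (\<Sum>b\<leftarrow>bs. b c)"

lemma colour_total_simps [simp]: "colour_total [] c = 0" "colour_total (b # bs) c = b c + colour_total bs c"
  by (simp_all add: colour_total_def)

text \<open>
  Summing by parts the exponents that a row picks up under the passage to holes gives a difference
  of values of this function at the top and the bottom boundary, for white and purple rows alike.
\<close>

fun height :: "nat \<Rightarrow> label list \<Rightarrow> int" where
  "height k [] = 0"
| "height k (b # bs) = height k bs + phi k (\<lambda>c. 1 - b c) (colour_total (b # bs))"

text \<open>One step of the summation by parts. Conservation expresses the total of the top word by
  \<open>J\<close> and the total of the bottom word; what remains is linearity of
  \<open>phi\<close>. The boundary term at the left end is \<open>phi\<close> of \<open>J\<close>
  and the bottom total.\<close>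

lemma height_step_white:
  assumes "conserved k b J t L" "\<forall>c\<in>{1..k}. L c + colour_total bs c = colour_total ts c"
  shows "phi k L (colour_total bs) + height k ts - height k bs + (phi k L b + phi k (\<lambda>c. 1 - t c) J)
       = phi k J (colour_total (b # bs)) + height k (t # ts) - height k (b # bs)"
proof -
  have c: "b c + J c = t c + L c \<and> L c + colour_total bs c = colour_total ts c" if "c \<in> {1..k}" for c
    using assms that by (auto simp: conserved_def)
  have "phi k (\<lambda>c. 1 - t c) (colour_total (t # ts)) = phi k (\<lambda>c. 1 - t c) (\<lambda>c. colour_total (b # bs) c + J c)"
    by (rule phi_cong) (use c in force)+
  moreover have "phi k (\<lambda>c. 1 - t c) (colour_total (b # bs)) = phi k (\<lambda>c. 1 - (b c + J c - L c)) (colour_total (b # bs))"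
    by (rule phi_cong) (use c in force)+
  moreover have "phi k X (colour_total (b # bs)) = phi k X b + phi k X (colour_total bs)" for X
    unfolding phi_add_right[symmetric] by (rule phi_cong) auto
  ultimately show ?thesis by (simp add: phi_linear del: colour_total_simps)
qed

text \<open>Here the boundary term involves the total of the top word instead. It too vanishes at an
  empty left edge, so both kinds of rows end up with the same difference of heights.\<close>

lemma height_step_purple:
  assumes "conserved k b J t L" "\<forall>c\<in>{1..k}. L c + colour_total bs c = colour_total ts c"
  shows "phi k L (colour_total ts) + height k ts - height k bs + (phi k L t + phi k (\<lambda>c. 1 - b c) J)
       = phi k J (colour_total (t # ts)) + height k (t # ts) - height k (b # bs)"
proof -
  have c: "b c + J c = t c + L c \<and> L c + colour_total bs c = colour_total ts c" if "c \<in> {1..k}" for c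
    using assms that by (auto simp: conserved_def)
  have "phi k (\<lambda>c. 1 - b c) (colour_total (b # bs)) = phi k (\<lambda>c. 1 - b c) (\<lambda>c. colour_total (t # ts) c - J c)"
    by (rule phi_cong) (use c in force)+
  moreover have "phi k (\<lambda>c. 1 - b c) (colour_total (t # ts)) = phi k (\<lambda>c. 1 - (t c + L c - J c)) (colour_total (t # ts))"
    by (rule phi_cong) (use c in force)+
  moreover have "phi k X (colour_total (t # ts)) = phi k X t + phi k X (colour_total ts)" for X
    unfolding phi_add_right[symmetric] by (rule phi_cong) auto
  ultimately show ?thesis by (simp add: phi_linear del: colour_total_simps)
qed

text \<open>Follow one nonzero term of the sum and add the conservation laws of its boxes: the inner
  edges cancel.\<close>

lemma row_conserved:
  assumes "\<And>I J K L. w I J K L \<noteq> 0 \<Longrightarrow> conserved k I J K L" "row k w J bs ts J' \<noteq> 0" "c \<in> {1..k}"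
  shows "J c + colour_total bs c = colour_total ts c + J' c"
  using assms(2)
proof (induction bs arbitrary: J ts)
  case Nil
  then show ?case by (cases ts) (auto split: if_splits)
next
  case (Cons b bs)
  then obtain u us where ts: "ts = u # us" by (cases ts) auto
  have "(\<Sum>L\<in>labels k. w b J u L * row k w L bs us J') \<noteq> 0" using Cons.prems ts by simp
  then obtain L where L: "L \<in> labels k" "w b J u L * row k w L bs us J' \<noteq> 0"
    by (rule sum.not_neutral_contains_not_neutral)
  then have "L c + colour_total bs c = colour_total us c + J' c" by (intro Cons.IH) auto
  moreover have "b c + J c = u c + L c"
    using assms(1)[of b J u L] L(2) assms(3) by (auto simp: conserved_def)
  ultimately show ?case using ts by simp
qed

text \<open>\<open>row\<close> recurses at its left end, but reflection moves the leftmost column to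
  the right end, so a recursion is needed there.\<close>

lemma row_snoc:
  assumes "length bs = length ts" "J \<in> labels k" "J' \<in> labels k"
  shows "row k w J (bs @ [b]) (ts @ [t]) J' = (\<Sum>L\<in>labels k. row k w J bs ts L * w b L t J')"
  using assms(1,2)
proof (induction bs ts arbitrary: J rule: list_induct2)
  case Nil
  then show ?case using assms(3) by (simp add: of_bool_def if_distrib if_distribR sum.delta' sum.delta cong: if_cong)
next
  case (Cons b' bs t' ts)
  have "row k w J ((b' # bs) @ [b]) ((t' # ts) @ [t]) J' =
     (\<Sum>M\<in>labels k. \<Sum>L\<in>labels k. w b' J t' M * row k w M bs ts L * w b L t J')"
    using Cons by (simp add: sum_distrib_left mult.assoc)
  also have "\<dots> = (\<Sum>L\<in>labels k. row k w J (b' # bs) (t' # ts) L * w b L t J')"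
    by (subst sum.swap) (simp add: sum_distrib_right)
  finally show ?case .
qed

definition hole_state :: "nat \<Rightarrow> label list \<Rightarrow> label list" where
  "hole_state k bs = rev (map (hole_label k) bs)"

text \<open>
  Reflection moves the weight \<open>x\<close> from right to left edges; the powers of \<open>x\<close> on both sides account
  for this without dividing by \<open>x\<close>, which may vanish.
\<close>

lemma row_holes:
  fixes t x :: "'a::field"
  assumes t: "t \<noteq> 0"
    and vertex: "\<And>I J K L. I \<in> labels k \<Longrightarrow> J \<in> labels k \<Longrightarrow> K \<in> labels k \<Longrightarrow> L \<in> labels k \<Longrightarrow>
      x powi label_size k J * w I J K L = x powi label_size k L * t powi \<delta> I J K L *
        w' (hole_label k I) (flip_label k L) (hole_label k K) (flip_label k J)"
    and w: "\<And>I J K L. w I J K L \<noteq> 0 \<Longrightarrow> conserved k I J K L"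
    and w': "\<And>I J K L. w' I J K L \<noteq> 0 \<Longrightarrow> conserved k I J K L"
    and D0: "D (empty_label k) [] [] = 0"
    and D: "\<And>b J t L bs ts. conserved k b J t L \<Longrightarrow> \<forall>c\<in>{1..k}. L c + colour_total bs c = colour_total ts c \<Longrightarrow>
      D L bs ts + \<delta> b J t L = D J (b # bs) (t # ts)"
    and J: "J \<in> labels k" and bs: "bs \<in> states k n" and ts: "ts \<in> states k n"
  shows "x powi label_size k J * row k w J bs ts (empty_label k) =
    t powi D J bs ts * row k w' (empty_label k) (hole_state k bs) (hole_state k ts) (flip_label k J)"
  using J bs ts
proof (induction n arbitrary: J bs ts)
  case 0
  have "empty_label k = flip_label k J \<longleftrightarrow> J = empty_label k"
    using flip_label_flip_label[OF 0(1)] flip_label_empty_label by metis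
  then show ?case using 0 D0 by (auto simp: hole_state_def)
next
  case (Suc n)
  let ?e = "empty_label k"
  obtain b bs' where b: "bs = b # bs'" "b \<in> labels k" "bs' \<in> states k n"
    using Suc.prems(2) by (auto simp: states_Suc)
  obtain u ts' where u: "ts = u # ts'" "u \<in> labels k" "ts' \<in> states k n"
    using Suc.prems(3) by (auto simp: states_Suc)
  have "x powi label_size k J * row k w J bs ts ?e =
      (\<Sum>L\<in>labels k. x powi label_size k J * w b J u L * row k w L bs' ts' ?e)"
    by (simp add: b u sum_distrib_left mult.assoc)
  also have "\<dots> = (\<Sum>L\<in>labels k. t powi D J bs ts *
     (row k w' ?e (hole_state k bs') (hole_state k ts') (flip_label k L) *
      w' (hole_label k b) (flip_label k L) (hole_label k u) (flip_label k J)))"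
  proof (rule sum.cong)
    fix L assume L: "L \<in> labels k"
    define r where "r = row k w L bs' ts' ?e"
    define r' where "r' = row k w' ?e (hole_state k bs') (hole_state k ts') (flip_label k L)"
    define v where "v = w' (hole_label k b) (flip_label k L) (hole_label k u) (flip_label k J)"
    have IH: "x powi label_size k L * r = t powi D L bs' ts' * r'"
      unfolding r_def r'_def by (rule Suc.IH[OF L b(3) u(3)])
    have "x powi label_size k J * w b J u L * r = t powi \<delta> b J u L * v * (x powi label_size k L * r)"
      unfolding vertex[OF b(2) Suc.prems(1) u(2) L] v_def by (simp add: mult_ac)
    also have "\<dots> = t powi (D L bs' ts' + \<delta> b J u L) * (r' * v)"
      unfolding IH using t by (simp add: power_int_add mult_ac)
    also have "\<dots> = t powi D J bs ts * (r' * v)"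
    \<comment> \<open>The recursion for \<open>D\<close> presupposes conservation in this column and
      in the rest of the row. Where that could fail, the term is 0 and the exponent is
      irrelevant.\<close>
    proof (cases "r' = 0 \<or> v = 0")
      case False
      have "conserved k b J u L" using False w' conserved_holes unfolding v_def by blast
      moreover have "r \<noteq> 0" using IH False t by auto
      then have "\<forall>c\<in>{1..k}. L c + colour_total bs' c = colour_total ts' c"
        unfolding r_def using row_conserved[where w = w and k = k and J = L and bs = bs' and ts = ts' and J' = ?e] w
        by (auto simp: empty_label_def)
      ultimately show ?thesis using D unfolding b u by simp
    qed auto
    finally show "x powi label_size k J * w b J u L * row k w L bs' ts' ?e = t powi D J bs ts *
     (row k w' ?e (hole_state k bs') (hole_state k ts') (flip_label k L) *
      w' (hole_label k b) (flip_label k L) (hole_label k u) (flip_label k J))"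
      unfolding r_def r'_def v_def .
  qed simp
  \<comment> \<open>Flipping permutes the labels, so the flipped inner edge can serve as the
    summation index of a row extended at its right end.\<close>
  also have "\<dots> = t powi D J bs ts *
     (\<Sum>L\<in>labels k. row k w' ?e (hole_state k bs') (hole_state k ts') L *
      w' (hole_label k b) L (hole_label k u) (flip_label k J))"
    unfolding sum_distrib_left[symmetric]
    by (subst sum_labels_flip[where f = "\<lambda>L. row k w' ?e (hole_state k bs') (hole_state k ts') L *
      w' (hole_label k b) L (hole_label k u) (flip_label k J)"]) (rule refl)
  also have "\<dots> = t powi D J bs ts * row k w' ?e (hole_state k bs) (hole_state k ts) (flip_label k J)"
    using Suc.prems b u by (simp add: hole_state_def row_snoc states_def)
  finally show ?case .
qed

definition transfer :: "nat \<Rightarrow> 'a::field vertex \<Rightarrow> label list \<Rightarrow> label list \<Rightarrow> 'a" where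
  "transfer k w bs ts = row k w (empty_label k) bs ts (empty_label k)"

lemma phi_empty_label [simp]: "phi k (empty_label k) X = 0"
  unfolding phi_def by (intro sum.neutral) (auto simp: empty_label_def)

lemma phi_colour_total_Nil [simp]: "phi k X (colour_total []) = 0"
  by (simp add: phi_def)

lemma transfer_white_holes:
  fixes t x :: "'a::field"
  assumes "t \<noteq> 0" "bs \<in> states k n" "ts \<in> states k n"
  shows "transfer k (white_weight k t x) bs ts = t powi (height k ts - height k bs) *
    transfer k (purple_weight k (inverse t) x) (hole_state k bs) (hole_state k ts)"
proof -
  \<comment> \<open>The exponent accumulated from an edge labelled \<open>J\<close> to the right end
    of the row; \<open>\<delta>\<close> is the surplus of one box.\<close>
  define D where "D = (\<lambda>J bs ts. phi k J (colour_total bs) + height k ts - height k bs)"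
  define \<delta> where "\<delta> = (\<lambda>I J K L. phi k L I + phi k (\<lambda>c. 1 - K c) J)"
  have "x powi label_size k (empty_label k) *
      row k (white_weight k t x) (empty_label k) bs ts (empty_label k) =
    t powi D (empty_label k) bs ts * row k (purple_weight k (inverse t) x) (empty_label k)
      (hole_state k bs) (hole_state k ts) (flip_label k (empty_label k))"
  proof (rule row_holes[where \<delta> = \<delta>, OF assms(1)])
    show "D L bs ts + \<delta> b J t L = D J (b # bs) (t # ts)"
      if "conserved k b J t L" "\<forall>c\<in>{1..k}. L c + colour_total bs c = colour_total ts c" for b J t L bs ts
      using height_step_white[OF that] by (simp only: D_def \<delta>_def)
  qed (use assms white_vertex_holes in \<open>auto simp: D_def \<delta>_def white_conserved purple_conserved\<close>)
  then show ?thesis by (simp add: transfer_def D_def)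
qed

lemma transfer_purple_holes:
  fixes t x :: "'a::field"
  assumes "t \<noteq> 0" "bs \<in> states k n" "ts \<in> states k n"
  shows "transfer k (purple_weight k t x) bs ts = t powi (height k ts - height k bs) *
    transfer k (white_weight k (inverse t) x) (hole_state k bs) (hole_state k ts)"
proof -
  define D where "D = (\<lambda>J bs ts. phi k J (colour_total ts) + height k ts - height k bs)"
  define \<delta> where "\<delta> = (\<lambda>I J K L. phi k L K + phi k (\<lambda>c. 1 - I c) J)"
  have "x powi label_size k (empty_label k) *
      row k (purple_weight k t x) (empty_label k) bs ts (empty_label k) =
    t powi D (empty_label k) bs ts * row k (white_weight k (inverse t) x) (empty_label k)
      (hole_state k bs) (hole_state k ts) (flip_label k (empty_label k))"
  proof (rule row_holes[where \<delta> = \<delta>, OF assms(1)])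
    show "D L bs ts + \<delta> b J t L = D J (b # bs) (t # ts)"
      if "conserved k b J t L" "\<forall>c\<in>{1..k}. L c + colour_total bs c = colour_total ts c" for b J t L bs ts
      using height_step_purple[OF that] by (simp only: D_def \<delta>_def)
  qed (use assms purple_vertex_holes in \<open>auto simp: D_def \<delta>_def purple_conserved white_conserved\<close>)
  then show ?thesis by (simp add: transfer_def D_def)
qed

section \<open>Products of transfer matrices and the lattice\<close>

text \<open>Entries of a matrix product over the index set \<open>S\<close>; the head of the list
  acts first, as the lowest row.\<close>

fun chain :: "'s set \<Rightarrow> ('s \<Rightarrow> 's \<Rightarrow> 'a::field) list \<Rightarrow> 's \<Rightarrow> 's \<Rightarrow> 'a" where
  "chain S [] b t = of_bool (b = t)"
| "chain S (T # Ts) b t = (\<Sum>m\<in>S. T b m * chain S Ts m t)"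

lemma chain_append:
  assumes "finite S" "b \<in> S"
  shows "chain S (Ts @ Us) b t = (\<Sum>m\<in>S. chain S Ts b m * chain S Us m t)"
  using assms(2)
proof (induction Ts arbitrary: b)
  case Nil
  then have "(\<Sum>m\<in>S. chain S [] b m * chain S Us m t) = (\<Sum>m\<in>S. if m = b then chain S Us m t else 0)"
    by (intro sum.cong) auto
  then show ?case using Nil assms(1) by simp
next
  case (Cons T Ts)
  have "chain S ((T # Ts) @ Us) b t = (\<Sum>m'\<in>S. \<Sum>m\<in>S. T b m' * chain S Ts m' m * chain S Us m t)"
    using Cons by (simp add: sum_distrib_left mult.assoc)
  also have "\<dots> = (\<Sum>m\<in>S. chain S (T # Ts) b m * chain S Us m t)"
    by (subst sum.swap) (simp add: sum_distrib_right)
  finally show ?case .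
qed

lemma chain_single:
  assumes "finite S" "t \<in> S" shows "chain S [T] b t = T b t"
proof -
  have "chain S [T] b t = (\<Sum>m\<in>S. if m = t then T b m else 0)"
    unfolding chain.simps by (intro sum.cong) auto
  then show ?thesis using assms by simp
qed

lemma chain_move:
  assumes "finite S" "b \<in> S"
    and "\<And>U b t. U \<in> set Us \<Longrightarrow> b \<in> S \<Longrightarrow> t \<in> S \<Longrightarrow> (\<Sum>m\<in>S. T b m * U m t) = (\<Sum>m\<in>S. U b m * T m t)"
  shows "chain S (T # Us) b t = chain S (Us @ [T]) b t"
  using assms(2,3)
proof (induction Us arbitrary: b)
  case (Cons U Us)
  have two: "chain S (X # Y # Us) b t = (\<Sum>m'\<in>S. (\<Sum>m\<in>S. X b m * Y m m') * chain S Us m' t)" for X Y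
    by (simp add: sum_distrib_left sum_distrib_right mult.assoc) (rule sum.swap)
  have "chain S (T # U # Us) b t = (\<Sum>m'\<in>S. (\<Sum>m\<in>S. T b m * U m m') * chain S Us m' t)"
    by (rule two)
  also have "\<dots> = (\<Sum>m'\<in>S. (\<Sum>m\<in>S. U b m * T m m') * chain S Us m' t)"
    using Cons.prems by (intro sum.cong refl) simp
  also have "\<dots> = (\<Sum>m\<in>S. U b m * chain S (T # Us) m t)"
    unfolding two[symmetric] by simp
  also have "\<dots> = (\<Sum>m\<in>S. U b m * chain S (Us @ [T]) m t)"
  proof (rule sum.cong)
    fix m assume "m \<in> S"
    then have "chain S (T # Us) m t = chain S (Us @ [T]) m t"
      by (rule Cons.IH) (rule Cons.prems(2), auto)
    then show "U b m * chain S (T # Us) m t = U b m * chain S (Us @ [T]) m t" by (rule arg_cong)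
  qed simp
  finally show ?case by simp
qed simp

lemma chain_commute:
  assumes "finite S" "b \<in> S"
    and "\<And>T U b t. T \<in> set Ts \<Longrightarrow> U \<in> set Us \<Longrightarrow> b \<in> S \<Longrightarrow> t \<in> S \<Longrightarrow>
      (\<Sum>m\<in>S. T b m * U m t) = (\<Sum>m\<in>S. U b m * T m t)"
  shows "chain S (Ts @ Us) b t = chain S (Us @ Ts) b t"
  using assms(2,3)
proof (induction Ts arbitrary: b)
  case (Cons T Ts)
  have "chain S ((T # Ts) @ Us) b t = (\<Sum>m\<in>S. T b m * chain S (Us @ Ts) m t)"
    unfolding append_Cons chain.simps
  proof (rule sum.cong)
    fix m assume "m \<in> S"
    then have "chain S (Ts @ Us) m t = chain S (Us @ Ts) m t"
      by (rule Cons.IH) (rule Cons.prems(2), auto)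
    then show "T b m * chain S (Ts @ Us) m t = T b m * chain S (Us @ Ts) m t" by (rule arg_cong)
  qed simp
  also have "\<dots> = chain S ((T # Us) @ Ts) b t" by simp
  also have "\<dots> = (\<Sum>m\<in>S. chain S (T # Us) b m * chain S Ts m t)"
    by (rule chain_append[OF assms(1) Cons.prems(1)])
  also have "\<dots> = (\<Sum>m\<in>S. chain S (Us @ [T]) b m * chain S Ts m t)"
  proof -
    have "chain S (T # Us) b m = chain S (Us @ [T]) b m" for m
      by (rule chain_move[OF assms(1) Cons.prems(1)]) (rule Cons.prems(2), auto)
    then show ?thesis by (simp only:)
  qed
  also have "\<dots> = chain S ((Us @ [T]) @ Ts) b t"
    by (rule chain_append[OF assms(1) Cons.prems(1), symmetric])
  finally show ?case by simp
qed simp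

text \<open>Conjugation by a diagonal matrix with entries \<open>q powi G b\<close>, combined with a
  permutation \<open>h\<close> of the indices, passes to products because the exponents at inner
  indices cancel.\<close>

lemma chain_conjugate:
  fixes q :: "'a::field" and G :: "'s \<Rightarrow> int"
  assumes "q \<noteq> 0" "bij_betw h S S"
    and "list_all2 (\<lambda>T U. \<forall>b\<in>S. \<forall>t\<in>S. T b t = q powi (G t - G b) * U (h b) (h t)) Ts Us"
    and "b \<in> S" "t \<in> S"
  shows "chain S Ts b t = q powi (G t - G b) * chain S Us (h b) (h t)"
  using assms(3,4)
proof (induction Ts Us arbitrary: b rule: list_all2_induct)
  case Nil
  have "h b = h t \<longleftrightarrow> b = t"
    using inj_on_eq_iff[OF bij_betw_imp_inj_on[OF assms(2)]] Nil assms(5) by blast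
  then show ?case by auto
next
  case (Cons T Ts U Us)
  have "chain S (T # Ts) b t = (\<Sum>m\<in>S. q powi (G t - G b) * (U (h b) (h m) * chain S Us (h m) (h t)))"
    unfolding chain.simps
  proof (rule sum.cong)
    fix m assume m: "m \<in> S"
    have "q powi (G t - G b) = q powi (G m - G b) * q powi (G t - G m)"
      using assms(1) by (simp flip: power_int_add)
    then show "T b m * chain S Ts m t = q powi (G t - G b) * (U (h b) (h m) * chain S Us (h m) (h t))"
      using Cons m by (simp add: mult_ac)
  qed simp
  also have "\<dots> = q powi (G t - G b) * (\<Sum>m\<in>S. U (h b) (h m) * chain S Us (h m) (h t))"
    by (simp add: sum_distrib_left)
  also have "(\<Sum>m\<in>S. U (h b) (h m) * chain S Us (h m) (h t)) = chain S (U # Us) (h b) (h t)"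
    using sum.reindex_bij_betw[OF assms(2), of "\<lambda>m. U (h b) m * chain S Us m (h t)"] by simp
  finally show ?case .
qed

lemma hole_state_in_states [simp]: "bs \<in> states k n \<Longrightarrow> hole_state k bs \<in> states k n"
  by (auto simp: states_def hole_state_def)

lemma hole_state_hole_state: "bs \<in> states k n \<Longrightarrow> hole_state k (hole_state k bs) = bs"
  by (auto simp: states_def hole_state_def rev_map intro!: map_idI)

lemma hole_state_bij: "bij_betw (hole_state k) (states k n) (states k n)"
  by (rule bij_betw_byWitness[where f' = "hole_state k"]) (auto simp: hole_state_hole_state)

text \<open>The theorem for arbitrary boundary words, before partitions enter: conjugate row by row,
  then move the rows that have become white below the purple ones.\<close>

lemma chain_states_conjugate:
  fixes t :: "'a::field"
  assumes "t \<noteq> 0" "bs \<in> states k n" "ts \<in> states k n"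
  shows "chain (states k n) (map (\<lambda>z. transfer k (white_weight k t z)) xs @
                             map (\<lambda>z. transfer k (purple_weight k t z)) ys) bs ts =
     t powi (height k ts - height k bs) *
     chain (states k n) (map (\<lambda>z. transfer k (white_weight k (inverse t) z)) ys @
                         map (\<lambda>z. transfer k (purple_weight k (inverse t) z)) xs)
       (hole_state k bs) (hole_state k ts)"
proof -
  have "chain (states k n) (map (\<lambda>z. transfer k (white_weight k t z)) xs @
                             map (\<lambda>z. transfer k (purple_weight k t z)) ys) bs ts =
     t powi (height k ts - height k bs) *
     chain (states k n) (map (\<lambda>z. transfer k (purple_weight k (inverse t) z)) xs @
                         map (\<lambda>z. transfer k (white_weight k (inverse t) z)) ys)
       (hole_state k bs) (hole_state k ts)"
    using assms transfer_white_holes[OF assms(1)] transfer_purple_holes[OF assms(1)]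
    by (intro chain_conjugate hole_state_bij list_all2_appendI)
       (auto simp: list.rel_map intro!: list.rel_refl_strong)
  also have "chain (states k n) (map (\<lambda>z. transfer k (purple_weight k (inverse t) z)) xs @
                         map (\<lambda>z. transfer k (white_weight k (inverse t) z)) ys)
       (hole_state k bs) (hole_state k ts) =
     chain (states k n) (map (\<lambda>z. transfer k (white_weight k (inverse t) z)) ys @
                         map (\<lambda>z. transfer k (purple_weight k (inverse t) z)) xs)
       (hole_state k bs) (hole_state k ts)"
  proof (rule chain_commute)
    fix T U and b u :: "label list"
    assume "T \<in> set (map (\<lambda>z. transfer k (purple_weight k (inverse t) z)) xs)"
      and "U \<in> set (map (\<lambda>z. transfer k (white_weight k (inverse t) z)) ys)"
      and b: "b \<in> states k n" "u \<in> states k n"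
    then obtain z z' where [simp]: "T = transfer k (purple_weight k (inverse t) z)"
        "U = transfer k (white_weight k (inverse t) z')" by auto
    have [simp]: "length b = n" using b by (simp add: states_def)
    show "(\<Sum>m\<in>states k n. T b m * U m u) = (\<Sum>m\<in>states k n. U b m * T m u)"
      using white_purple_commute[OF b, of "inverse t" z' z] by (simp add: two_rows_def transfer_def)
  qed (use assms in simp_all)
  finally show ?thesis .
qed

section \<open>Empty columns at the right end\<close>

definition vacuous_right :: "nat \<Rightarrow> 'a::field vertex \<Rightarrow> bool" where
  "vacuous_right k w \<longleftrightarrow> (\<forall>b\<in>labels k. \<forall>J\<in>labels k.
     w b J (empty_label k) (empty_label k) = of_bool (b = empty_label k \<and> J = empty_label k))"

lemma colour_label_eq_empty: "S \<subseteq> {1..k} \<Longrightarrow> colour_label k S = empty_label k \<longleftrightarrow> S = {}"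
  using colour_label_eq_iff[of S k "{}"] by simp

lemma vacuous_right_white: "vacuous_right k (white_weight k t x)"
  unfolding vacuous_right_def
proof (intro ballI)
  fix b J assume "b \<in> labels k" "J \<in> labels k"
  then obtain B A where "B \<subseteq> {1..k}" "b = colour_label k B" "A \<subseteq> {1..k}" "J = colour_label k A"
    by (auto elim!: obtain_colours)
  then show "white_weight k t x b J (empty_label k) (empty_label k) = of_bool (b = empty_label k \<and> J = empty_label k)"
    using white_weight_colours[of B k A "{}" "{}" t x] by (auto simp: colour_label_eq_empty white_set_def)
qed

lemma vacuous_right_purple: "vacuous_right k (purple_weight k t x)"
  unfolding vacuous_right_def
proof (intro ballI)
  fix b J assume "b \<in> labels k" "J \<in> labels k"
  then obtain B A where "B \<subseteq> {1..k}" "b = colour_label k B" "A \<subseteq> {1..k}" "J = colour_label k A"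
    by (auto elim!: obtain_colours)
  then show "purple_weight k t x b J (empty_label k) (empty_label k) = of_bool (b = empty_label k \<and> J = empty_label k)"
    using purple_weight_colours[of B k A "{}" "{}" t x] by (auto simp: colour_label_eq_empty purple_set_def)
qed

lemma states_snoc: "states k (Suc n) = (\<lambda>(b, bs). bs @ [b]) ` (labels k \<times> states k n)"
proof (intro equalityI subsetI)
  fix bs assume bs: "bs \<in> states k (Suc n)"
  then obtain cs c where "bs = cs @ [c]" by (cases bs rule: rev_cases) (auto simp: states_def)
  then show "bs \<in> (\<lambda>(b, bs). bs @ [b]) ` (labels k \<times> states k n)"
    using bs by (auto simp: states_def image_iff)
qed (auto simp: states_def)

lemma sum_states_snoc: "sum f (states k (Suc n)) = (\<Sum>bs\<in>states k n. \<Sum>b\<in>labels k. f (bs @ [b]))"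
proof -
  have "sum f (states k (Suc n)) = (\<Sum>p\<in>labels k \<times> states k n. f (snd p @ [fst p]))"
    unfolding states_snoc by (subst sum.reindex) (auto simp: inj_on_def case_prod_unfold)
  also have "\<dots> = (\<Sum>b\<in>labels k. \<Sum>bs\<in>states k n. f (bs @ [b]))"
    by (simp add: sum.cartesian_product case_prod_unfold)
  finally show ?thesis by (simp add: sum.swap[of _ "labels k"])
qed

lemma transfer_snoc_empty:
  assumes "vacuous_right k w" "bs \<in> states k n" "ts \<in> states k n" "b \<in> labels k"
  shows "transfer k w (bs @ [b]) (ts @ [empty_label k]) = of_bool (b = empty_label k) * transfer k w bs ts"
proof -
  have "transfer k w (bs @ [b]) (ts @ [empty_label k]) =
    (\<Sum>L\<in>labels k. if L = empty_label k then of_bool (b = empty_label k) * row k w (empty_label k) bs ts L else 0)"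
    unfolding transfer_def using assms
    by (subst row_snoc) (auto simp: states_def vacuous_right_def intro!: sum.cong)
  then show ?thesis by (simp add: transfer_def)
qed

text \<open>Emptiness spreads downwards: an empty top of the last column, together with the empty
  right boundary, forces every edge below it to be empty, and then all boxes there have weight
  1.\<close>

lemma chain_snoc_empty:
  assumes "\<forall>w\<in>set ws. vacuous_right k w" "bs \<in> states k n" "ts \<in> states k n" "b \<in> labels k"
  shows "chain (states k (Suc n)) (map (transfer k) ws) (bs @ [b]) (ts @ [empty_label k]) =
    of_bool (b = empty_label k) * chain (states k n) (map (transfer k) ws) bs ts"
  using assms
proof (induction ws arbitrary: bs b)
  case (Cons w ws)
  have "chain (states k (Suc n)) (map (transfer k) (w # ws)) (bs @ [b]) (ts @ [empty_label k]) =
    (\<Sum>ms\<in>states k n. \<Sum>c\<in>labels k. if c = empty_label k then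
        transfer k w (bs @ [b]) (ms @ [c]) * chain (states k n) (map (transfer k) ws) ms ts else 0)"
    unfolding list.map chain.simps sum_states_snoc
    using Cons by (intro sum.cong refl) auto
  also have "\<dots> = (\<Sum>ms\<in>states k n. transfer k w (bs @ [b]) (ms @ [empty_label k]) * chain (states k n) (map (transfer k) ws) ms ts)"
    by simp
  also have "\<dots> = of_bool (b = empty_label k) * chain (states k n) (map (transfer k) (w # ws)) bs ts"
    using Cons.prems by (simp add: transfer_snoc_empty sum_distrib_left mult.assoc)
  finally show ?case .
qed auto

section \<open>From sums over labellings to matrix products\<close>

lemma sum_right_functions:
  fixes a b :: int
  assumes "a \<le> b + 1" "J \<in> labels k" "J' \<in> labels k"
  shows "(\<Sum>h\<in>{h \<in> {a..b + 1} \<rightarrow>\<^sub>E labels k. h a = J \<and> h (b + 1) = J'}.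
            \<Prod>c\<in>{a..b}. w (lo c) (h c) (up c) (h (c + 1))) =
         row k w J (map lo [a..b]) (map up [a..b]) J'"
  using assms(1,2)
proof (induction "nat (b + 1 - a)" arbitrary: a J)
  case 0
  then have a: "a = b + 1" by simp
  have "{h \<in> {a..b + 1} \<rightarrow>\<^sub>E labels k. h a = J \<and> h (b + 1) = J'} = (if J = J' then {\<lambda>c\<in>{a}. J} else {})"
    using 0 unfolding a by (auto simp: PiE_iff extensional_def fun_eq_iff)
  then show ?case unfolding a by simp
next
  case (Suc d)
  then have a: "a \<le> b" by simp
  \<comment> \<open>Labellings of the edges to the right of \<open>a\<close>, sorted by the label
    \<open>L\<close> of the first of them, so that the induction hypothesis applies for each
    \<open>L\<close>.\<close>
  define HS where "HS = (\<lambda>L. {h \<in> {a + 1..b + 1} \<rightarrow>\<^sub>E labels k. h (a + 1) = L \<and> h (b + 1) = J'})"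
  have sp: "{a..b} = insert a {a + 1..b}" "{a..b + 1} = insert a {a + 1..b + 1}" using a by auto
  have fin: "finite (HS L)" for L unfolding HS_def by (intro finite_Collect_conjI) (simp add: finite_PiE)
  have "(\<Sum>h\<in>{h \<in> {a..b + 1} \<rightarrow>\<^sub>E labels k. h a = J \<and> h (b + 1) = J'}.
            \<Prod>c\<in>{a..b}. w (lo c) (h c) (up c) (h (c + 1))) =
      (\<Sum>(L, h)\<in>(SIGMA L:labels k. HS L). w (lo a) J (up a) L * (\<Prod>c\<in>{a + 1..b}. w (lo c) (h c) (up c) (h (c + 1))))"
  proof (rule sum.reindex_bij_witness[where i = "\<lambda>(L, h). h(a := J)" and j = "\<lambda>h. (h (a + 1), restrict h {a + 1..b + 1})"])
    fix h assume h: "h \<in> {h \<in> {a..b + 1} \<rightarrow>\<^sub>E labels k. h a = J \<and> h (b + 1) = J'}"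
    show "(case (h (a + 1), restrict h {a + 1..b + 1}) of (L, h) \<Rightarrow> h(a := J)) = h"
    proof
      fix c show "(case (h (a + 1), restrict h {a + 1..b + 1}) of (L, h) \<Rightarrow> h(a := J)) c = h c"
        using h a by (cases "c = a"; cases "c \<in> {a..b + 1}") (auto simp: PiE_iff extensional_def)
    qed
    show "(h (a + 1), restrict h {a + 1..b + 1}) \<in> (SIGMA L:labels k. HS L)"
      using h a by (auto simp: HS_def PiE_iff)
    have "(\<Prod>c\<in>{a..b}. w (lo c) (h c) (up c) (h (c + 1))) =
       w (lo a) (h a) (up a) (h (a + 1)) * (\<Prod>c\<in>{a + 1..b}. w (lo c) (h c) (up c) (h (c + 1)))"
      unfolding sp(1) by simp
    also have "(\<Prod>c\<in>{a + 1..b}. w (lo c) (h c) (up c) (h (c + 1))) =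
       (\<Prod>c\<in>{a + 1..b}. w (lo c) (restrict h {a + 1..b + 1} c) (up c) (restrict h {a + 1..b + 1} (c + 1)))"
      by (rule prod.cong) auto
    finally show "(case (h (a + 1), restrict h {a + 1..b + 1}) of (L, h) \<Rightarrow>
        w (lo a) J (up a) L * (\<Prod>c\<in>{a + 1..b}. w (lo c) (h c) (up c) (h (c + 1)))) =
        (\<Prod>c\<in>{a..b}. w (lo c) (h c) (up c) (h (c + 1)))"
      using h by simp
  next
    fix p assume "p \<in> (SIGMA L:labels k. HS L)"
    then obtain L h where p: "p = (L, h)" "L \<in> labels k" "h \<in> HS L" by auto
    show "(case p of (L, h) \<Rightarrow> h(a := J)) \<in> {h \<in> {a..b + 1} \<rightarrow>\<^sub>E labels k. h a = J \<and> h (b + 1) = J'}"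
      using p a Suc.prems unfolding sp(2) by (auto simp: HS_def PiE_iff extensional_def)
    have "restrict (h(a := J)) {a + 1..b + 1} = h"
    proof
      fix c show "restrict (h(a := J)) {a + 1..b + 1} c = h c"
        using p by (auto simp: HS_def PiE_iff extensional_def)
    qed
    then show "((case p of (L, h) \<Rightarrow> h(a := J)) (a + 1),
        restrict (case p of (L, h) \<Rightarrow> h(a := J)) {a + 1..b + 1}) = p"
      using p by (auto simp: HS_def)
  qed
  also have "\<dots> = (\<Sum>L\<in>labels k. w (lo a) J (up a) L *
      (\<Sum>h\<in>HS L. \<Prod>c\<in>{a + 1..b}. w (lo c) (h c) (up c) (h (c + 1))))"
    using fin by (simp add: sum.Sigma[symmetric] sum_distrib_left)
  also have "\<dots> = (\<Sum>L\<in>labels k. w (lo a) J (up a) L * row k w L (map lo [a + 1..b]) (map up [a + 1..b]) J')"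
    unfolding HS_def using Suc a by (intro sum.cong refl arg_cong2[where f = "(*)"] Suc.hyps(1)) auto
  finally show ?case using a by (simp add: upto_rec1)
qed

lemma map_upto_bij:
  "bij_betw (\<lambda>f. map f [a..b]) ({a..b} \<rightarrow>\<^sub>E labels k) (states k (length [a..b]))"
proof (rule bij_betw_byWitness[where f' = "\<lambda>bs. \<lambda>c\<in>{a..b}. bs ! nat (c - a)"])
  show "\<forall>f\<in>{a..b} \<rightarrow>\<^sub>E labels k. (\<lambda>c\<in>{a..b}. map f [a..b] ! nat (c - a)) = f"
  proof
    fix f assume f: "f \<in> {a..b} \<rightarrow>\<^sub>E labels k"
    show "(\<lambda>c\<in>{a..b}. map f [a..b] ! nat (c - a)) = f"
    proof
      fix c show "(\<lambda>c\<in>{a..b}. map f [a..b] ! nat (c - a)) c = f c"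
        using f by (cases "c \<in> {a..b}") (auto simp: nth_upto PiE_iff extensional_def)
    qed
  qed
  show "\<forall>bs\<in>states k (length [a..b]). map (\<lambda>c\<in>{a..b}. bs ! nat (c - a)) [a..b] = bs"
    by (auto simp: states_def nth_upto intro!: nth_equalityI)
  show "(\<lambda>f. map f [a..b]) ` ({a..b} \<rightarrow>\<^sub>E labels k) \<subseteq> states k (length [a..b])"
    by (auto simp: states_def PiE_iff)
  show "(\<lambda>bs. \<lambda>c\<in>{a..b}. bs ! nat (c - a)) ` states k (length [a..b]) \<subseteq> {a..b} \<rightarrow>\<^sub>E labels k"
  proof
    fix f assume "f \<in> (\<lambda>bs. \<lambda>c\<in>{a..b}. bs ! nat (c - a)) ` states k (length [a..b])"
    then obtain bs where bs: "bs \<in> states k (length [a..b])" and f: "f = (\<lambda>c\<in>{a..b}. bs ! nat (c - a))" by auto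
    have "bs ! nat (c - a) \<in> labels k" if "c \<in> {a..b}" for c
      using bs that by (auto simp: states_def intro!: subsetD[OF _ nth_mem])
    then show "f \<in> {a..b} \<rightarrow>\<^sub>E labels k" unfolding f by simp
  qed
qed

text \<open>\<open>configs\<close> with arbitrary boundary words: cutting off the top row leaves a
  word that need not come from partitions.\<close>

definition lattice_configs ::
    "nat \<Rightarrow> int \<Rightarrow> int \<Rightarrow> nat \<Rightarrow> (int \<Rightarrow> label) \<Rightarrow> (int \<Rightarrow> label) \<Rightarrow>
     ((nat \<times> int \<Rightarrow> label) \<times> (nat \<times> int \<Rightarrow> label)) set" where
  "lattice_configs k a b R lo up =
     {(V, H). V \<in> {0..R} \<times> {a..b} \<rightarrow>\<^sub>E labels k
            \<and> H \<in> {1..R} \<times> {a..b + 1} \<rightarrow>\<^sub>E labels k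
            \<and> (\<forall>c\<in>{a..b}. V (0, c) = lo c \<and> V (R, c) = up c)
            \<and> (\<forall>r\<in>{1..R}. H (r, a) = empty_label k \<and> H (r, b + 1) = empty_label k)}"

definition config_weight ::
    "int \<Rightarrow> int \<Rightarrow> nat \<Rightarrow> (nat \<Rightarrow> 'a::field vertex) \<Rightarrow> (nat \<times> int \<Rightarrow> label) \<times> (nat \<times> int \<Rightarrow> label) \<Rightarrow> 'a" where
  "config_weight a b R w = (\<lambda>(V, H). \<Prod>r = 1..R. \<Prod>c = a..b.
     w r (V (r - 1, c)) (H (r, c)) (V (r, c)) (H (r, c + 1)))"

lemma finite_lattice_configs [simp]: "finite (lattice_configs k a b R lo up)"
  by (rule finite_subset[of _ "({0..R} \<times> {a..b} \<rightarrow>\<^sub>E labels k) \<times> ({1..R} \<times> {a..b + 1} \<rightarrow>\<^sub>E labels k)"])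
     (auto simp: lattice_configs_def intro!: finite_PiE)

lemma sum_lattice_configs_Suc:
  assumes ab: "a \<le> b + 1" and up: "\<And>c. c \<in> {a..b} \<Longrightarrow> up c \<in> labels k"
  shows "sum (config_weight a b (Suc R) w) (lattice_configs k a b (Suc R) lo up) =
    (\<Sum>mid\<in>{a..b} \<rightarrow>\<^sub>E labels k. sum (config_weight a b R w) (lattice_configs k a b R lo mid) *
       (\<Sum>h\<in>{h \<in> {a..b + 1} \<rightarrow>\<^sub>E labels k. h a = empty_label k \<and> h (b + 1) = empty_label k}.
          \<Prod>c\<in>{a..b}. w (Suc R) (mid c) (h c) (up c) (h (c + 1))))"
proof -
  define HS where "HS = {h \<in> {a..b + 1} \<rightarrow>\<^sub>E labels k. h a = empty_label k \<and> h (b + 1) = empty_label k}"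
  define rw where "rw = (\<lambda>mid h. \<Prod>c\<in>{a..b}. w (Suc R) (mid c) (h c) (up c) (h (c + 1)))"
  define Z where "Z = (SIGMA mid:{a..b} \<rightarrow>\<^sub>E labels k. lattice_configs k a b R lo mid \<times> HS)"
  \<comment> \<open>\<open>fw\<close> cuts below the top row and \<open>bw\<close> glues. The edges
    at the cut belong to both pieces; \<open>bw\<close> takes them from the lower one, whose top
    boundary is \<open>mid\<close>.\<close>
  define fw where "fw = (\<lambda>(V, H). (\<lambda>c\<in>{a..b}. V (R, c) :: label,
     (restrict V ({0..R} \<times> {a..b}), restrict H ({1..R} \<times> {a..b + 1})), \<lambda>c\<in>{a..b + 1}. H (Suc R, c) :: label))"
  define bw where "bw = (\<lambda>(mid :: int \<Rightarrow> label, (V, H), h :: int \<Rightarrow> label).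
     (\<lambda>(r, c)\<in>{0..Suc R} \<times> {a..b}. if r = Suc R then up c else V (r, c),
      \<lambda>(r, c)\<in>{1..Suc R} \<times> {a..b + 1}. if r = Suc R then h c else H (r, c)))"
  have finHS: "finite HS" unfolding HS_def by (intro finite_Collect_conjI) (simp add: finite_PiE)
  have "sum (config_weight a b (Suc R) w) (lattice_configs k a b (Suc R) lo up) =
    (\<Sum>(mid, VH, h)\<in>Z. config_weight a b R w VH * rw mid h)"
  proof (rule sum.reindex_bij_witness[where i = bw and j = fw])
    fix VH assume VH: "VH \<in> lattice_configs k a b (Suc R) lo up"
    then obtain V H where VH_eq: "VH = (V, H)" and V: "V \<in> {0..Suc R} \<times> {a..b} \<rightarrow>\<^sub>E labels k"
      and H: "H \<in> {1..Suc R} \<times> {a..b + 1} \<rightarrow>\<^sub>E labels k"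
      and Vb: "\<And>c. c \<in> {a..b} \<Longrightarrow> V (0, c) = lo c" "\<And>c. c \<in> {a..b} \<Longrightarrow> V (Suc R, c) = up c"
      and Hb: "\<And>r. r \<in> {1..Suc R} \<Longrightarrow> H (r, a) = empty_label k" "\<And>r. r \<in> {1..Suc R} \<Longrightarrow> H (r, b + 1) = empty_label k"
      by (auto simp: lattice_configs_def)
    show "bw (fw VH) = VH"
      unfolding VH_eq fw_def bw_def prod.case
    proof (intro prod.expand conjI, goal_cases)
      case 1
      show ?case unfolding fst_conv
      proof
        fix p show "(\<lambda>(r, c)\<in>{0..Suc R} \<times> {a..b}. if r = Suc R then up c else restrict V ({0..R} \<times> {a..b}) (r, c)) p = V p"
          using V Vb(2) by (cases p; cases "p \<in> {0..Suc R} \<times> {a..b}") (auto simp: PiE_iff extensional_def)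
      qed
    next
      case 2
      show ?case unfolding snd_conv
      proof
        fix p show "(\<lambda>(r, c)\<in>{1..Suc R} \<times> {a..b + 1}. if r = Suc R then (\<lambda>c\<in>{a..b + 1}. H (Suc R, c)) c
            else restrict H ({1..R} \<times> {a..b + 1}) (r, c)) p = H p"
          using H by (cases p; cases "p \<in> {1..Suc R} \<times> {a..b + 1}") (auto simp: PiE_iff extensional_def)
      qed
    qed
    show "fw VH \<in> Z"
    proof -
      have "(\<lambda>c\<in>{a..b}. V (R, c)) \<in> {a..b} \<rightarrow>\<^sub>E labels k" using V by (auto simp: PiE_iff)
      moreover have "(restrict V ({0..R} \<times> {a..b}), restrict H ({1..R} \<times> {a..b + 1})) \<in>
          lattice_configs k a b R lo (\<lambda>c\<in>{a..b}. V (R, c))"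
        unfolding lattice_configs_def using V H Vb Hb ab by (auto simp: PiE_iff)
      moreover have "(\<lambda>c\<in>{a..b + 1}. H (Suc R, c)) \<in> HS"
        unfolding HS_def using H Hb ab by (auto simp: PiE_iff)
      ultimately show ?thesis unfolding VH_eq fw_def Z_def by auto
    qed
    show "(case fw VH of (mid, VH, h) \<Rightarrow> config_weight a b R w VH * rw mid h) = config_weight a b (Suc R) w VH"
    proof -
      have "config_weight a b R w (restrict V ({0..R} \<times> {a..b}), restrict H ({1..R} \<times> {a..b + 1})) =
          config_weight a b R w (V, H)"
        unfolding config_weight_def prod.case by (intro prod.cong refl) auto
      moreover have "rw (\<lambda>c\<in>{a..b}. V (R, c)) (\<lambda>c\<in>{a..b + 1}. H (Suc R, c)) =
          (\<Prod>c\<in>{a..b}. w (Suc R) (V (R, c)) (H (Suc R, c)) (V (Suc R, c)) (H (Suc R, c + 1)))"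
        unfolding rw_def using Vb by (intro prod.cong refl) auto
      ultimately show ?thesis unfolding VH_eq fw_def by (simp add: config_weight_def)
    qed
  next
    fix z assume "z \<in> Z"
    then obtain mid V H h where z: "z = (mid, (V, H), h)" and mid: "mid \<in> {a..b} \<rightarrow>\<^sub>E labels k"
      and VH: "(V, H) \<in> lattice_configs k a b R lo mid" and h: "h \<in> HS" by (auto simp: Z_def)
    have V: "V \<in> {0..R} \<times> {a..b} \<rightarrow>\<^sub>E labels k"
      and H: "H \<in> {1..R} \<times> {a..b + 1} \<rightarrow>\<^sub>E labels k"
      and Vb: "\<And>c. c \<in> {a..b} \<Longrightarrow> V (0, c) = lo c" "\<And>c. c \<in> {a..b} \<Longrightarrow> V (R, c) = mid c"
      and Hb: "\<And>r. r \<in> {1..R} \<Longrightarrow> H (r, a) = empty_label k" "\<And>r. r \<in> {1..R} \<Longrightarrow> H (r, b + 1) = empty_label k"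
      using VH by (auto simp: lattice_configs_def)
    show "bw z \<in> lattice_configs k a b (Suc R) lo up"
      unfolding z bw_def prod.case lattice_configs_def mem_Collect_eq
      using V H Vb Hb h up ab unfolding HS_def by (auto simp: PiE_iff)
    have "(\<lambda>c\<in>{a..b}. (\<lambda>(r, c)\<in>{0..Suc R} \<times> {a..b}. if r = Suc R then up c else V (r, c)) (R, c)) = mid"
      using mid Vb(2) by (intro extensionalityI[of _ "{a..b}"]) (auto simp: PiE_def)
    moreover have "restrict (\<lambda>(r, c)\<in>{0..Suc R} \<times> {a..b}. if r = Suc R then up c else V (r, c)) ({0..R} \<times> {a..b}) = V"
      using V by (intro extensionalityI[of _ "{0..R} \<times> {a..b}"]) (auto simp: PiE_def)
    moreover have "restrict (\<lambda>(r, c)\<in>{1..Suc R} \<times> {a..b + 1}. if r = Suc R then h c else H (r, c)) ({1..R} \<times> {a..b + 1}) = H"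
      using H by (intro extensionalityI[of _ "{1..R} \<times> {a..b + 1}"]) (auto simp: PiE_def)
    moreover have "(\<lambda>c\<in>{a..b + 1}. (\<lambda>(r, c)\<in>{1..Suc R} \<times> {a..b + 1}. if r = Suc R then h c else H (r, c)) (Suc R, c)) = h"
      using h unfolding HS_def by (intro extensionalityI[of _ "{a..b + 1}"]) (auto simp: PiE_def)
    ultimately show "fw (bw z) = z"
      unfolding z fw_def bw_def prod.case by (simp only:)
  qed
  also have "\<dots> = (\<Sum>mid\<in>{a..b} \<rightarrow>\<^sub>E labels k. \<Sum>(VH, h)\<in>lattice_configs k a b R lo mid \<times> HS. config_weight a b R w VH * rw mid h)"
    unfolding Z_def using finHS by (subst sum.Sigma) (auto simp: finite_PiE)
  also have "\<dots> = (\<Sum>mid\<in>{a..b} \<rightarrow>\<^sub>E labels k. sum (config_weight a b R w) (lattice_configs k a b R lo mid) * sum (rw mid) HS)"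
    by (simp add: sum_product sum.cartesian_product)
  finally show ?thesis unfolding rw_def HS_def .
qed

text \<open>The induction removes the top row, whereas \<open>chain\<close> recurses at the bottom;
  \<open>chain_append\<close> mediates.\<close>

lemma config_sum_eq_chain:
  assumes "a \<le> b + 1" "\<And>c. c \<in> {a..b} \<Longrightarrow> lo c \<in> labels k" "\<And>c. c \<in> {a..b} \<Longrightarrow> up c \<in> labels k"
  shows "sum (config_weight a b R w) (lattice_configs k a b R lo up) =
    chain (states k (length [a..b])) (map (\<lambda>r. transfer k (w r)) [1..<R + 1]) (map lo [a..b]) (map up [a..b])"
  using assms(3)
proof (induction R arbitrary: up)
  case 0
  show ?case
  proof (cases "map lo [a..b] = map up [a..b]")
    case True
    have "lattice_configs k a b 0 lo up = {(\<lambda>(r, c)\<in>{0} \<times> {a..b}. lo c, \<lambda>_. undefined)}"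
    proof (intro equalityI subsetI)
      fix z assume "z \<in> lattice_configs k a b 0 lo up"
      then obtain V H where z: "z = (V, H)" and V: "V \<in> {0} \<times> {a..b} \<rightarrow>\<^sub>E labels k"
        and H: "H = (\<lambda>_. undefined)" and lo: "\<And>c. c \<in> {a..b} \<Longrightarrow> V (0, c) = lo c"
        by (auto simp: lattice_configs_def)
      have "V = (\<lambda>(r, c)\<in>{0} \<times> {a..b}. lo c)"
        using V lo by (intro extensionalityI[of _ "{0} \<times> {a..b}"]) (auto simp: PiE_def)
      then show "z \<in> {(\<lambda>(r, c)\<in>{0} \<times> {a..b}. lo c, \<lambda>_. undefined)}" using z H by simp
    qed (use True assms(2) in \<open>auto simp: lattice_configs_def\<close>)
    then show ?thesis using True by (simp add: config_weight_def)
  next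
    case False
    then have "lattice_configs k a b 0 lo up = {}" by (auto simp: lattice_configs_def)
    then show ?thesis using False by simp
  qed
next
  case (Suc R)
  let ?S = "states k (length [a..b])" and ?T = "map (\<lambda>r. transfer k (w r)) [1..<R + 1]"
  have lo: "map lo [a..b] \<in> ?S" and up: "map up [a..b] \<in> ?S"
    using assms(2) Suc.prems by (auto simp: states_def)
  have "sum (config_weight a b (Suc R) w) (lattice_configs k a b (Suc R) lo up) =
    (\<Sum>mid\<in>{a..b} \<rightarrow>\<^sub>E labels k. sum (config_weight a b R w) (lattice_configs k a b R lo mid) *
       (\<Sum>h\<in>{h \<in> {a..b + 1} \<rightarrow>\<^sub>E labels k. h a = empty_label k \<and> h (b + 1) = empty_label k}.
          \<Prod>c\<in>{a..b}. w (Suc R) (mid c) (h c) (up c) (h (c + 1))))"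
    by (rule sum_lattice_configs_Suc[OF assms(1) Suc.prems])
  also have "\<dots> = (\<Sum>mid\<in>{a..b} \<rightarrow>\<^sub>E labels k. chain ?S ?T (map lo [a..b]) (map mid [a..b]) *
       transfer k (w (Suc R)) (map mid [a..b]) (map up [a..b]))"
  proof (rule sum.cong)
    fix mid assume "mid \<in> {a..b} \<rightarrow>\<^sub>E labels k"
    then have "sum (config_weight a b R w) (lattice_configs k a b R lo mid) =
        chain ?S ?T (map lo [a..b]) (map mid [a..b])"
      by (intro Suc.IH) auto
    then show "sum (config_weight a b R w) (lattice_configs k a b R lo mid) *
       (\<Sum>h\<in>{h \<in> {a..b + 1} \<rightarrow>\<^sub>E labels k. h a = empty_label k \<and> h (b + 1) = empty_label k}.
          \<Prod>c\<in>{a..b}. w (Suc R) (mid c) (h c) (up c) (h (c + 1))) =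
       chain ?S ?T (map lo [a..b]) (map mid [a..b]) *
       transfer k (w (Suc R)) (map mid [a..b]) (map up [a..b])"
      using sum_right_functions[OF assms(1), of "empty_label k" k "empty_label k" "w (Suc R)" mid up]
      by (simp add: transfer_def)
  qed simp
  also have "\<dots> = (\<Sum>ms\<in>?S. chain ?S ?T (map lo [a..b]) ms * transfer k (w (Suc R)) ms (map up [a..b]))"
    by (rule sum.reindex_bij_betw[OF map_upto_bij])
  also have "\<dots> = (\<Sum>ms\<in>?S. chain ?S ?T (map lo [a..b]) ms * chain ?S [transfer k (w (Suc R))] ms (map up [a..b]))"
    by (simp only: chain_single[OF finite_states up])
  also have "\<dots> = chain ?S (?T @ [transfer k (w (Suc R))]) (map lo [a..b]) (map up [a..b])"
    by (rule chain_append[OF finite_states lo, symmetric])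
  finally show ?case by simp
qed

definition row_list :: "nat \<Rightarrow> 'a::field \<Rightarrow> 'a list \<Rightarrow> 'a list \<Rightarrow> 'a vertex list" where
  "row_list k t xs ys = map (white_weight k t) xs @ map (purple_weight k t) ys"

definition column_labels :: "nat \<Rightarrow> nat \<Rightarrow> (nat \<Rightarrow> partition) \<Rightarrow> int \<Rightarrow> label list" where
  "column_labels k l lam b = map (boundary_label k l lam) [- int l..b]"

lemma boundary_label_in_labels [simp]: "boundary_label k l lam c \<in> labels k"
  by (auto simp: boundary_label_def labels_def restrict_PiE_iff)

lemma column_labels_in_states: "column_labels k l lam b \<in> states k (length [- int l..b])"
  by (auto simp: column_labels_def states_def)

lemma LS_eq_chain:
  "LS k l N lam mu n x m y t =
    chain (states k (length [- int l..int N])) (map (transfer k) (row_list k t (map x [1..<n + 1]) (map y [1..<m + 1])))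
      (column_labels k l mu (int N)) (column_labels k l lam (int N))"
proof -
  define w where "w = (\<lambda>r. if r \<le> n then white_weight k t (x r) else purple_weight k t (y (r - n)))"
  have "LS k l N lam mu n x m y t = sum (config_weight (- int l) (int N) (n + m) w)
     (lattice_configs k (- int l) (int N) (n + m) (boundary_label k l mu) (boundary_label k l lam))"
    by (simp only: LS_def config_weight_def lattice_configs_def configs_def w_def)
  also have "\<dots> = chain (states k (length [- int l..int N])) (map (\<lambda>r. transfer k (w r)) [1..<n + m + 1])
      (column_labels k l mu (int N)) (column_labels k l lam (int N))"
    unfolding column_labels_def by (rule config_sum_eq_chain) auto
  also have "map (\<lambda>r. transfer k (w r)) [1..<n + m + 1] =
      map (transfer k) (row_list k t (map x [1..<n + 1]) (map y [1..<m + 1]))"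
  proof -
    have "[1..<n + m + 1] = [1..<n + 1] @ [n + 1..<n + 1 + m]"
      using upt_add_eq_append[of 1 "n + 1" m] by (simp add: add_ac)
    also have "[n + 1..<n + 1 + m] = map (\<lambda>i. i + n) [1..<m + 1]"
      by (intro nth_equalityI) (auto simp del: upt_Suc)
    finally have sp: "[1..<n + m + 1] = [1..<n + 1] @ map (\<lambda>i. i + n) [1..<m + 1]" .
    show ?thesis
      unfolding sp row_list_def map_append map_map
      by (intro arg_cong2[where f = "(@)"] map_cong refl) (auto simp: w_def simp del: upt_Suc)
  qed
  finally show ?thesis .
qed

lemma row_list_vacuous: "\<forall>w\<in>set (row_list k t xs ys). vacuous_right k w"
  by (auto simp: row_list_def vacuous_right_white vacuous_right_purple)

text \<open>This is what makes the choice of \<open>N\<close> immaterial once all path endpoints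
  fit.\<close>

lemma chain_columns_extend:
  assumes "b \<le> b'" "- int l - 1 \<le> b"
    and "\<And>c. b < c \<Longrightarrow> boundary_label k l lam c = empty_label k"
    and "\<And>c. b < c \<Longrightarrow> boundary_label k l mu c = empty_label k"
  shows "chain (states k (length [- int l..b'])) (map (transfer k) (row_list k t xs ys))
      (column_labels k l mu b') (column_labels k l lam b') =
    chain (states k (length [- int l..b])) (map (transfer k) (row_list k t xs ys))
      (column_labels k l mu b) (column_labels k l lam b)"
  using assms(1)
proof (induction b' rule: int_ge_induct)
  case (step i)
  have i: "[- int l..i + 1] = [- int l..i] @ [i + 1]" using step assms(2) by (simp add: upto_rec2)
  have "column_labels k l nu (i + 1) = column_labels k l nu i @ [empty_label k]" if "nu = lam \<or> nu = mu" for nu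
    using that assms(3,4) step by (auto simp: column_labels_def i)
  then show ?case
    using chain_snoc_empty[OF row_list_vacuous[of k t xs ys] column_labels_in_states[of k l mu i]
        column_labels_in_states[of k l lam i] empty_label_in_labels] step
    by (simp add: i del: length_upto)
qed simp

section \<open>Conjugate partitions and the function g\<close>

text \<open>The parts of size at least \<open>j\<close> form an initial segment, whose length is
  \<open>conj_partition p j\<close>. The later facts on conjugates rest on this equivalence.\<close>

lemma conj_partition_le_iff:
  assumes "is_partition p" "1 \<le> i" "1 \<le> j"
  shows "i \<le> conj_partition p j \<longleftrightarrow> j \<le> p i"
proof -
  let ?S = "{i. 1 \<le> i \<and> j \<le> p i}"
  have fin: "finite ?S"
    by (rule finite_subset[of _ "{i. 1 \<le> i \<and> p i \<noteq> 0}"]) (use assms in \<open>auto simp: is_partition_def\<close>)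
  have mono: "p i' \<le> p i" if "1 \<le> i" "i \<le> i'" for i i'
    using assms(1) that by (auto simp: is_partition_def)
  show ?thesis
  proof
    assume "j \<le> p i"
    then have "{1..i} \<subseteq> ?S" using mono by (auto intro: order_trans)
    then have "card {1..i} \<le> card ?S" by (rule card_mono[OF fin])
    then show "i \<le> conj_partition p j" by (simp add: conj_partition_def)
  next
    assume le: "i \<le> conj_partition p j"
    show "j \<le> p i"
    proof (rule ccontr)
      assume n: "\<not> j \<le> p i"
      have "?S \<subseteq> {1..<i}"
      proof
        fix i' assume i': "i' \<in> ?S"
        then have "i' < i" using n mono[of i i'] assms(2) by (cases "i' < i") auto
        then show "i' \<in> {1..<i}" using i' by simp
      qed
      then have "card ?S \<le> card {1..<i}" by (intro card_mono) auto
      then show False using le assms(2) by (simp add: conj_partition_def)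
    qed
  qed
qed

lemma partition_eq_0:
  assumes "is_partition p" "num_parts p \<le> l" "l < i"
  shows "p i = 0"
proof -
  have "num_parts p = conj_partition p 1"
    unfolding num_parts_def conj_partition_def by (rule arg_cong[where f = card]) auto
  then show ?thesis using conj_partition_le_iff[OF assms(1), of i 1] assms by simp
qed

lemma num_parts_conj_partition:
  assumes "is_partition p" shows "num_parts (conj_partition p) = p 1"
proof -
  have "{j. 1 \<le> j \<and> conj_partition p j \<noteq> 0} = {1..p 1}"
    using conj_partition_le_iff[OF assms, of 1] by (auto simp: Suc_le_eq)
  then show ?thesis by (simp add: num_parts_def)
qed

lemma conj_partition_le:
  assumes "is_partition p" "num_parts p \<le> l" "1 \<le> j"
  shows "conj_partition p j \<le> l"
proof (rule ccontr)
  assume n: "\<not> conj_partition p j \<le> l"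
  then have "p (conj_partition p j) = 0" by (intro partition_eq_0[OF assms(1,2)]) auto
  then show False using conj_partition_le_iff[OF assms(1), of "conj_partition p j" j] assms n by simp
qed

text \<open>With \<open>q\<close> the conjugate, the numbers \<open>p i - i\<close> and
  \<open>j - 1 - q j\<close> form two sets of \<open>l\<close> elements in the window from
  \<open>- l\<close> to \<open>l - 1\<close>. They are disjoint, since \<open>j \<le> p i\<close>
  decides which of the two numbers is larger; so by counting they fill the window.\<close>

lemma maya_complement:
  assumes p: "is_partition p" "num_parts p \<le> l" "p 1 \<le> l" and c: "- int l \<le> c" "c < int l"
  shows "(\<exists>j\<in>{1..l}. - 1 - c = int (conj_partition p j) - int j) \<longleftrightarrow>
         \<not> (\<exists>j\<in>{1..l}. c = int (p j) - int j)"
proof -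
  let ?q = "conj_partition p"
  have mono: "p j \<le> p i" if "1 \<le> i" "i \<le> j" for i j using p(1) that by (auto simp: is_partition_def)
  define A where "A = (\<lambda>j. int (p j) - int j) ` {1..l}"
  define B where "B = (\<lambda>j. int j - 1 - int (?q j)) ` {1..l}"
  have "inj_on (\<lambda>j. int (p j) - int j) {1..l}"
  proof (rule linorder_inj_onI)
    fix i j assume "i < j" "i \<in> {1..l}" "j \<in> {1..l}"
    then show "int (p i) - int i \<noteq> int (p j) - int j" using mono[of i j] by auto
  qed auto
  then have cA: "card A = l" by (simp add: A_def card_image)
  have "inj_on (\<lambda>j. int j - 1 - int (?q j)) {1..l}"
  proof (rule linorder_inj_onI)
    fix i j assume ij: "i < j" "i \<in> {1..l}" "j \<in> {1..l}"
    have "?q j \<le> ?q i"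
    proof (cases "?q j = 0")
      case False
      then show ?thesis using conj_partition_le_iff[OF p(1), of "?q j" i] conj_partition_le_iff[OF p(1), of "?q j" j] ij by auto
    qed simp
    then show "int i - 1 - int (?q i) \<noteq> int j - 1 - int (?q j)" using ij by auto
  qed auto
  then have cB: "card B = l" by (simp add: B_def card_image)
  have disj: "A \<inter> B = {}"
  proof -
    have "int (p i) - int i \<noteq> int j - 1 - int (?q j)" if "i \<in> {1..l}" "j \<in> {1..l}" for i j
      using conj_partition_le_iff[OF p(1), of i j] that by (cases "j \<le> p i") auto
    then show ?thesis unfolding A_def B_def by blast
  qed
  have pl: "p j \<le> l" if "1 \<le> j" for j using mono[of 1 j] p(3) that by simp
  have sub: "A \<union> B \<subseteq> {- int l..<int l}"
    using pl conj_partition_le[OF p(1,2)] unfolding A_def B_def by fastforce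
  have "card (A \<union> B) = card {- int l..<int l}"
    using cA cB disj by (subst card_Un_disjoint) (auto simp: A_def B_def)
  then have "A \<union> B = {- int l..<int l}" using sub by (intro card_subset_eq) auto
  then have "c \<in> A \<union> B" using c by auto
  then have "c \<in> B \<longleftrightarrow> c \<notin> A" using disj by auto
  moreover have "c \<in> A \<longleftrightarrow> (\<exists>j\<in>{1..l}. c = int (p j) - int j)" by (auto simp: A_def)
  moreover have "c \<in> B \<longleftrightarrow> (\<exists>j\<in>{1..l}. - 1 - c = int (?q j) - int j)"
    unfolding B_def image_iff by (rule bex_cong) auto
  ultimately show ?thesis by blast
qed

lemma boundary_label_conj:
  assumes "\<forall>a\<in>{1..k}. is_partition (lam a) \<and> num_parts (lam a) \<le> l \<and> lam a 1 \<le> l"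
    and "- int l \<le> c" "c < int l"
  shows "boundary_label k l (conj_tuple k lam) (- 1 - c) = hole_label k (boundary_label k l lam c)"
proof
  fix a
  show "boundary_label k l (conj_tuple k lam) (- 1 - c) a = hole_label k (boundary_label k l lam c) a"
  proof (cases "a \<in> {1..k}")
    case True
    then have "k + 1 - a \<in> {1..k}" by auto
    then show ?thesis
      using True maya_complement[of "lam (k + 1 - a)" l c] assms
      by (auto simp: boundary_label_def hole_label_def conj_tuple_def)
  qed (auto simp: boundary_label_def hole_label_def)
qed

text \<open>The window is symmetric under \<open>c\<close> to \<open>- 1 - c\<close>, so reflecting
  the columns just reverses the word.\<close>

lemma column_labels_conj:
  assumes "\<forall>a\<in>{1..k}. is_partition (lam a) \<and> num_parts (lam a) \<le> l \<and> lam a 1 \<le> l"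
  shows "column_labels k l (conj_tuple k lam) (int l - 1) = hole_state k (column_labels k l lam (int l - 1))"
  unfolding column_labels_def hole_state_def
proof (rule nth_equalityI)
  fix i assume "i < length (map (boundary_label k l (conj_tuple k lam)) [- int l..int l - 1])"
  then have i: "i < 2 * l" by simp
  define c where "c = int l - 1 - int i"
  have c: "- int l \<le> c" "c < int l" "- int l + int i = - 1 - c"
    "- int l + (int (2 * l) - int (Suc i)) = c" using i by (auto simp: c_def)
  have "map (boundary_label k l (conj_tuple k lam)) [- int l..int l - 1] ! i =
      boundary_label k l (conj_tuple k lam) (- 1 - c)"
    using i c(3) by (simp add: nth_upto c_def)
  also have "\<dots> = hole_label k (boundary_label k l lam c)" by (rule boundary_label_conj[OF assms c(1,2)])
  also have "\<dots> = rev (map (hole_label k) (map (boundary_label k l lam) [- int l..int l - 1])) ! i"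
    using i c by (simp add: rev_nth nth_upto of_nat_diff)
  finally show "map (boundary_label k l (conj_tuple k lam)) [- int l..int l - 1] ! i =
      rev (map (hole_label k) (map (boundary_label k l lam) [- int l..int l - 1])) ! i" .
qed simp

section \<open>The single white rows behind g\<close>

locale interlacing =
  fixes l :: nat and al be :: partition
  assumes ge: "\<And>j. 1 \<le> j \<Longrightarrow> j \<le> l \<Longrightarrow> be j \<le> al j"
    and le: "\<And>j. 1 \<le> j \<Longrightarrow> j < l \<Longrightarrow> al (Suc j) \<le> be j"
begin

lemma al_le_be: "1 \<le> i \<Longrightarrow> i < j \<Longrightarrow> j \<le> l \<Longrightarrow> al j \<le> be i"
proof (induction j)
  case (Suc j)
  show ?case
  proof (cases "i = j")
    case False
    have "al (Suc j) \<le> be j" using Suc.prems by (intro le) auto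
    also have "be j \<le> al j" using Suc.prems by (intro ge) auto
    also have "al j \<le> be i" using Suc False by auto
    finally show ?thesis .
  qed (use le Suc.prems in auto)
qed simp

definition in_path :: "int \<Rightarrow> nat \<Rightarrow> bool" where
  "in_path c j \<longleftrightarrow> j \<in> {1..l} \<and> int (be j) - int j \<le> c \<and> c \<le> int (al j) - int j"

text \<open>For i < j, path \<open>j\<close> exits strictly to the left of the column where path
  \<open>i\<close> enters, by \<open>al_le_be\<close>.\<close>

lemma in_path_unique:
  assumes "in_path c i" "in_path c j" shows "i = j"
proof (rule ccontr)
  assume "i \<noteq> j"
  then have "i < j \<or> j < i" by auto
  then show False
    using assms al_le_be[of i j] al_le_be[of j i] by (auto simp: in_path_def)
qed

lemma occ_in_path:
  assumes "in_path c j"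
  shows "occ_bottom l al be c \<longleftrightarrow> c = int (be j) - int j" "occ_top l al be c \<longleftrightarrow> c = int (al j) - int j"
    "occ_left l al be c \<longleftrightarrow> int (be j) - int j < c" "occ_right l al be c \<longleftrightarrow> c < int (al j) - int j"
proof -
  have u: "i = j" if "i \<in> {1..l}" "int (be i) - int i \<le> c" "c \<le> int (al i) - int i" for i
    using in_path_unique[OF _ assms] that by (auto simp: in_path_def)
  have j: "j \<in> {1..l}" "int (be j) - int j \<le> c" "c \<le> int (al j) - int j"
    using assms by (auto simp: in_path_def)
  have g: "int (be i) - int i \<le> int (al i) - int i" if "i \<in> {1..l}" for i using ge[of i] that by auto
  show "occ_bottom l al be c \<longleftrightarrow> c = int (be j) - int j"
    unfolding occ_bottom_def using u g j by (metis order_refl)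
  show "occ_top l al be c \<longleftrightarrow> c = int (al j) - int j"
    unfolding occ_top_def using u g j by (metis order_refl)
  show "occ_left l al be c \<longleftrightarrow> int (be j) - int j < c"
    unfolding occ_left_def using u j by (metis less_imp_le)
  show "occ_right l al be c \<longleftrightarrow> c < int (al j) - int j"
    unfolding occ_right_def using u j by (metis less_imp_le)
qed

lemma occ_not_in_path:
  assumes "\<not> (\<exists>j. in_path c j)"
  shows "\<not> occ_bottom l al be c" "\<not> occ_top l al be c" "\<not> occ_left l al be c" "\<not> occ_right l al be c"
proof -
  have n: "\<not> (int (be i) - int i \<le> c \<and> c \<le> int (al i) - int i)" if "i \<in> {1..l}" for i
    using assms that by (auto simp: in_path_def)
  have g: "int (be i) - int i \<le> int (al i) - int i" if "i \<in> {1..l}" for i using ge[of i] that by auto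
  show "\<not> occ_bottom l al be c" unfolding occ_bottom_def using n g by (metis order_refl)
  show "\<not> occ_top l al be c" unfolding occ_top_def using n g by (metis order_refl)
  show "\<not> occ_left l al be c" unfolding occ_left_def using n by (metis less_imp_le)
  show "\<not> occ_right l al be c" unfolding occ_right_def using n by (metis less_imp_le)
qed

text \<open>Recovers the conditions of a white box, for one colour, from the description by
  paths.\<close>

lemma occ_relations:
  shows "occ_bottom l al be c \<Longrightarrow> \<not> occ_left l al be c"
    and "occ_top l al be c \<Longrightarrow> \<not> occ_right l al be c"
    and "occ_bottom l al be c \<or> occ_left l al be c \<longleftrightarrow> occ_top l al be c \<or> occ_right l al be c"
proof -
  have "(occ_bottom l al be c \<longrightarrow> \<not> occ_left l al be c) \<and> (occ_top l al be c \<longrightarrow> \<not> occ_right l al be c) \<and>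
    (occ_bottom l al be c \<or> occ_left l al be c \<longleftrightarrow> occ_top l al be c \<or> occ_right l al be c)"
  proof (cases "\<exists>j. in_path c j")
    case True
    then obtain j where "in_path c j" by blast
    then show ?thesis unfolding occ_in_path[OF \<open>in_path c j\<close>] by (auto simp: in_path_def)
  qed (simp add: occ_not_in_path)
  then show "occ_bottom l al be c \<Longrightarrow> \<not> occ_left l al be c"
    and "occ_top l al be c \<Longrightarrow> \<not> occ_right l al be c"
    and "occ_bottom l al be c \<or> occ_left l al be c \<longleftrightarrow> occ_top l al be c \<or> occ_right l al be c" by blast+
qed

end

lemma occ_right_eq_left: "occ_right l al be c \<longleftrightarrow> occ_left l al be (c + 1)"
  by (auto simp: occ_right_def occ_left_def)

text \<open>For i < j a box is good iff \<open>L i * I j + (1 - K i) * J j\<close> is 1: if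
  \<open>i\<close> is on the right edge, it is not on top, and the value tells whether
  \<open>j\<close> enters the box; otherwise the box must be free of \<open>i\<close>, with
  \<open>j\<close> on its left edge. So the good boxes count the surplus of
  \<open>white_vertex_holes\<close>, and \<open>height_step_white\<close> sums it.\<close>

lemma g_tilde_eq_height:
  assumes inter: "\<And>a. a \<in> {1..k} \<Longrightarrow> interlacing l (al a) (be a)"
    and bound: "\<And>a j. a \<in> {1..k} \<Longrightarrow> j \<in> {1..l} \<Longrightarrow> al a j \<le> l"
  shows "int (g_tilde k l al be) =
    height k (column_labels k l al (int l - 1)) - height k (column_labels k l be (int l - 1))"
proof -
  define J where "J = (\<lambda>c a. of_bool (occ_left l (al a) (be a) c) :: int)"
  let ?b = "boundary_label k l be" and ?t = "boundary_label k l al"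
  define \<delta> where "\<delta> = (\<lambda>c. phi k (J (c + 1)) (?b c) + phi k (\<lambda>a. 1 - ?t c a) (J c))"
  define P where "P = {(i, j). 1 \<le> i \<and> i < j \<and> j \<le> k}"
  have finP: "finite P" unfolding P_def by (rule finite_subset[of _ "{1..k} \<times> {1..k}"]) auto
  have b: "?b c a = of_bool (occ_bottom l (al a) (be a) c)" "?t c a = of_bool (occ_top l (al a) (be a) c)"
    if "a \<in> {1..k}" for a c using that by (auto simp: boundary_label_def occ_bottom_def occ_top_def)
  have J_right: "J (c + 1) a = of_bool (occ_right l (al a) (be a) c)" for c a
    by (simp add: J_def occ_right_eq_left)
  have cons: "conserved k (?b c) (J c) (?t c) (J (c + 1))" for c
    unfolding conserved_def
  proof
    fix a assume a: "a \<in> {1..k}"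
    interpret interlacing l "al a" "be a" by (rule inter[OF a])
    show "?b c a + J c a = ?t c a + J (c + 1) a"
      unfolding b[OF a] J_right using occ_relations[of c] by (auto simp: J_def)
  qed
  \<comment> \<open>Paths exit at column \<open>l - 1\<close> at the latest, so the unbounded row
    has all its good boxes inside the window.\<close>
  have empty: "\<not> occ_some l (al a) (be a) c" if "a \<in> {1..k}" "c \<ge> int l" for a c
  proof -
    interpret interlacing l "al a" "be a" by (rule inter[OF that(1)])
    have "\<not> in_path c j" for j
      using bound[OF that(1), of j] that(2) by (auto simp: in_path_def)
    then show ?thesis using occ_not_in_path by (auto simp: occ_some_def)
  qed
  have good: "int (card {(i, j) \<in> P. good_box l al be c i j}) = \<delta> c" for c
  proof -
    have "\<delta> c = (\<Sum>(i, j)\<in>P. J (c + 1) i * ?b c j + (1 - ?t c i) * J c j)"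
      unfolding \<delta>_def phi_def P_def by (simp add: sum.distrib[symmetric] case_prod_unfold)
    also have "\<dots> = (\<Sum>p\<in>P. of_bool (good_box l al be c (fst p) (snd p)))"
    proof (rule sum.cong)
      fix p assume "p \<in> P"
      then obtain i j where p: "p = (i, j)" "i \<in> {1..k}" "j \<in> {1..k}" by (auto simp: P_def)
      interpret i: interlacing l "al i" "be i" by (rule inter[OF p(2)])
      interpret j: interlacing l "al j" "be j" by (rule inter[OF p(3)])
      show "(case p of (i, j) \<Rightarrow> J (c + 1) i * ?b c j + (1 - ?t c i) * J c j) =
          of_bool (good_box l al be c (fst p) (snd p))"
        unfolding p(1) prod.case fst_conv snd_conv b[OF p(2)] b[OF p(3)] J_right good_box_def occ_some_def
        using i.occ_relations[of c] j.occ_relations[of c] by (auto simp: J_def)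
    qed simp
    also have "\<dots> = int (card (P \<inter> {p. good_box l al be c (fst p) (snd p)}))"
      using finP by (simp add: of_bool_def sum.If_cases)
    also have "P \<inter> {p. good_box l al be c (fst p) (snd p)} = {(i, j) \<in> P. good_box l al be c i j}" by auto
    finally show ?thesis by simp
  qed
  have sigma: "{(c, i, j). - int l \<le> c \<and> 1 \<le> i \<and> i < j \<and> j \<le> k \<and> good_box l al be c i j} =
      (SIGMA c:{- int l..int l - 1}. {(i, j) \<in> P. good_box l al be c i j})"
  proof -
    have "c < int l" if "good_box l al be c i j" "j \<in> {1..k}" for c i j
    proof (rule ccontr)
      assume "\<not> c < int l"
      then show False using empty[OF that(2), of c] that(1) by (auto simp: good_box_def occ_some_def)
    qed
    then show ?thesis by (fastforce simp: P_def)
  qed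
  have gt: "int (g_tilde k l al be) = (\<Sum>c\<in>{- int l..int l - 1}. \<delta> c)"
  proof -
    have "finite {(i, j) \<in> P. good_box l al be c i j}" for c
      by (rule finite_subset[OF _ finP]) auto
    then show ?thesis unfolding g_tilde_def sigma by (simp add: good[symmetric])
  qed
  \<comment> \<open>Summation by parts from the right end; the first conjunct is carried along as
    the conservation hypothesis of \<open>height_step_white\<close>.\<close>
  have "(\<forall>a\<in>{1..k}. J c a + colour_total (map ?b [c..int l - 1]) a = colour_total (map ?t [c..int l - 1]) a) \<and>
      (\<Sum>c\<in>{c..int l - 1}. \<delta> c) = phi k (J c) (colour_total (map ?b [c..int l - 1]))
        + height k (map ?t [c..int l - 1]) - height k (map ?b [c..int l - 1])"
    if "c \<le> int l" for c
    using that
  proof (induction "nat (int l - c)" arbitrary: c)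
    case 0
    then have c: "c = int l" by simp
    have "J c a = 0" if "a \<in> {1..k}" for a using empty[OF that, of c] c by (simp add: J_def occ_some_def)
    moreover have "[c..int l - 1] = []" using c by simp
    ultimately show ?case using c by (simp add: phi_def)
  next
    case (Suc d)
    then have c: "c < int l" by simp
    then have u: "[c..int l - 1] = c # [c + 1..int l - 1]" and s: "{c..int l - 1} = insert c {c + 1..int l - 1}"
      by (auto simp: upto_rec1)
    have IH: "\<forall>a\<in>{1..k}. J (c + 1) a + colour_total (map ?b [c + 1..int l - 1]) a = colour_total (map ?t [c + 1..int l - 1]) a"
      "(\<Sum>c\<in>{c + 1..int l - 1}. \<delta> c) = phi k (J (c + 1)) (colour_total (map ?b [c + 1..int l - 1]))
        + height k (map ?t [c + 1..int l - 1]) - height k (map ?b [c + 1..int l - 1])"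
      using Suc.hyps(1)[of "c + 1"] Suc.hyps(2) c by auto
    have "(\<Sum>c\<in>{c..int l - 1}. \<delta> c) = (\<Sum>c\<in>{c + 1..int l - 1}. \<delta> c) + \<delta> c" unfolding s by simp
    also have "\<dots> = phi k (J c) (colour_total (map ?b [c..int l - 1]))
        + height k (map ?t [c..int l - 1]) - height k (map ?b [c..int l - 1])"
      unfolding IH(2) unfolding \<delta>_def u list.map by (rule height_step_white[OF cons IH(1)])
    finally show ?case
      using IH(1) cons[of c] unfolding u conserved_def by force
  qed
  from this[of "- int l"] have "(\<Sum>c\<in>{- int l..int l - 1}. \<delta> c) = phi k (J (- int l)) (colour_total (map ?b [- int l..int l - 1]))
        + height k (map ?t [- int l..int l - 1]) - height k (map ?b [- int l..int l - 1])" by simp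
  \<comment> \<open>Paths enter at column \<open>- l\<close> or further right, so the leftmost edge
    is empty and the boundary term vanishes.\<close>
  moreover have "J (- int l) = (\<lambda>_. 0)" by (auto simp: J_def occ_left_def)
  ultimately show ?thesis unfolding gt column_labels_def by (simp add: phi_def)
qed

text \<open>From \<open>r - 1\<close> to \<open>r\<close> one more part is put in front and the
  others move by one place, so the second inequality holds even with equality where the parts are
  not padding.\<close>

lemma interlacing_last_parts:
  assumes "is_partition (rho a)" "1 \<le> r" "r \<le> l"
  shows "interlacing l (last_parts l rho r a) (last_parts l rho (r - 1) a)"
proof
  have mono: "rho a j \<le> rho a i" if "1 \<le> i" "i \<le> j" for i j
    using assms(1) that by (auto simp: is_partition_def)
  fix j :: nat assume j: "1 \<le> j"
  show "last_parts l rho (r - 1) a j \<le> last_parts l rho r a j"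
    using j assms(2,3) by (auto simp: last_parts_def intro!: mono)
  show "last_parts l rho r a (Suc j) \<le> last_parts l rho (r - 1) a j"
    using j assms(2,3) by (auto simp: last_parts_def Suc_diff_le)
qed

text \<open>Telescoping over \<open>last_parts l rho r\<close>, from the zero tuple at
  \<open>r = 0\<close> to \<open>rho\<close> at \<open>r = l\<close>. The height of the zero tuple
  is not 0 in general, but it cancels between \<open>lam\<close> and \<open>mu\<close>.\<close>

lemma g_eq_height:
  assumes "\<forall>a\<in>{1..k}. is_partition (rho a) \<and> rho a 1 \<le> l"
  shows "int (g k l rho) = height k (column_labels k l rho (int l - 1)) -
     height k (column_labels k l (\<lambda>_ _. 0) (int l - 1))"
proof -
  define h where "h = (\<lambda>r. height k (column_labels k l (last_parts l rho r) (int l - 1)))"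
  have "int (g_tilde k l (last_parts l rho r) (last_parts l rho (r - 1))) = h r - h (r - 1)"
    if "r \<in> {1..l}" for r
    unfolding h_def
  proof (rule g_tilde_eq_height)
    fix a assume a: "a \<in> {1..k}"
    show "interlacing l (last_parts l rho r a) (last_parts l rho (r - 1) a)"
      using assms that a by (intro interlacing_last_parts) auto
    fix j assume j: "j \<in> {1..l}"
    have "rho a (l - r + j) \<le> rho a 1" using assms a j by (auto simp: is_partition_def)
    then show "last_parts l rho r a j \<le> l" using assms a by (auto simp: last_parts_def intro: order_trans)
  qed
  then have "int (g k l rho) = (\<Sum>r = 1..l. h r - h (r - 1))" by (simp add: g_def)
  also have "\<dots> = h l - h 0"
    by (induction l) auto
  also have "h l = height k (column_labels k l rho (int l - 1))"
    unfolding h_def column_labels_def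
    by (intro arg_cong[where f = "height k"] map_cong refl) (auto simp: boundary_label_def last_parts_def fun_eq_iff restrict_def)
  also have "h 0 = height k (column_labels k l (\<lambda>_ _. 0) (int l - 1))"
    unfolding h_def column_labels_def
    by (intro arg_cong[where f = "height k"] map_cong refl) (auto simp: boundary_label_def last_parts_def fun_eq_iff restrict_def)
  finally show ?thesis .
qed

section \<open>Reduction to the symmetric window and conclusion\<close>

lemma boundary_label_right_empty:
  assumes "\<And>a j. a \<in> {1..k} \<Longrightarrow> j \<in> {1..l} \<Longrightarrow> int (lam a j) - int j < c"
  shows "boundary_label k l lam c = empty_label k"
  unfolding boundary_label_def empty_label_def using assms by (intro restrict_ext) force

text \<open>\<open>N\<close> may lie on either side of \<open>l - 1\<close>. No boundary entry lies
  beyond either end, so the columns between them can be added or dropped.\<close>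

lemma LS_eq_chain_window:
  assumes "fits k l N lam" "fits k l N mu"
    and bound: "\<And>a j. a \<in> {1..k} \<Longrightarrow> j \<in> {1..l} \<Longrightarrow> lam a j \<le> l \<and> mu a j \<le> l"
  shows "LS k l N lam mu n x m y t =
    chain (states k (2 * l)) (map (transfer k) (row_list k t (map x [1..<n + 1]) (map y [1..<m + 1])))
      (column_labels k l mu (int l - 1)) (column_labels k l lam (int l - 1))"
proof -
  define Z where "Z = (\<lambda>b. chain (states k (length [- int l..b]))
    (map (transfer k) (row_list k t (map x [1..<n + 1]) (map y [1..<m + 1])))
      (column_labels k l mu b) (column_labels k l lam b))"
  have N: "boundary_label k l lam c = empty_label k" "boundary_label k l mu c = empty_label k" if "int N < c" for c
    using assms(1,2) that by (force simp: fits_def intro!: boundary_label_right_empty)+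
  have W: "boundary_label k l lam c = empty_label k" "boundary_label k l mu c = empty_label k" if "int l - 1 < c" for c
    using bound that by (force intro!: boundary_label_right_empty)+
  have "Z (int N) = Z (int l - 1)"
  proof (cases "int N \<le> int l - 1")
    case True
    then show ?thesis unfolding Z_def using N by (intro chain_columns_extend[symmetric]) auto
  next
    case False
    then show ?thesis unfolding Z_def using W by (intro chain_columns_extend) auto
  qed
  moreover have "length [- int l..int l - 1] = 2 * l" by simp
  ultimately show ?thesis by (simp only: LS_eq_chain Z_def)
qed

theorem theorem4p3:
  fixes k l n m N N' :: nat
    and lam mu :: "nat \<Rightarrow> partition"
    and x y :: "nat \<Rightarrow> 'a::field"
    and t :: 'a
  assumes "k \<ge> 1"
    and "t \<noteq> 0"
    and "\<forall>a\<in>{1..k}. is_partition (lam a) \<and> is_partition (mu a)"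
    and "\<forall>a\<in>{1..k}. num_parts (lam a) \<le> l \<and> num_parts (mu a) \<le> l"
    and "\<forall>a\<in>{1..k}. num_parts (conj_tuple k lam a) \<le> l \<and> num_parts (conj_tuple k mu a) \<le> l"
    and "fits k l N lam" and "fits k l N mu"
    and "fits k l N' (conj_tuple k lam)" and "fits k l N' (conj_tuple k mu)"
  shows "LS k l N lam mu n x m y t
       = t powi (int (g k l lam) - int (g k l mu))
         * LS k l N' (conj_tuple k lam) (conj_tuple k mu) m y n x (inverse t)"
proof -
  have rev: "k + 1 - a \<in> {1..k}" if "a \<in> {1..k}" for a using that by auto
  have part: "is_partition (nu a) \<and> num_parts (nu a) \<le> l \<and> nu a 1 \<le> l"
    if "a \<in> {1..k}" "nu = lam \<or> nu = mu" for a nu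
  proof -
    have p: "is_partition (nu a)" "num_parts (nu a) \<le> l" using assms(3,4) that by auto
    \<comment> \<open>The bound on the conjugates enters as a bound on the first parts of the
      partitions themselves, which keeps all entries inside the window.\<close>
    have "num_parts (conj_tuple k nu (k + 1 - a)) \<le> l"
      using assms(5) rev[OF that(1)] that(2) by blast
    moreover have "conj_tuple k nu (k + 1 - a) = conj_partition (nu a)"
      using that(1) by (simp add: conj_tuple_def)
    ultimately show ?thesis using p num_parts_conj_partition[OF p(1)] by simp
  qed
  then have part_lam: "\<forall>a\<in>{1..k}. is_partition (lam a) \<and> num_parts (lam a) \<le> l \<and> lam a 1 \<le> l"
    and part_mu: "\<forall>a\<in>{1..k}. is_partition (mu a) \<and> num_parts (mu a) \<le> l \<and> mu a 1 \<le> l" by blast+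
  have bound: "nu a j \<le> l" if "a \<in> {1..k}" "j \<in> {1..l}" "nu = lam \<or> nu = mu" for a j nu
  proof -
    have "nu a j \<le> nu a 1" using part[OF that(1,3)] that(2) by (auto simp: is_partition_def)
    then show ?thesis using part[OF that(1,3)] by simp
  qed
  have bound': "conj_tuple k nu a j \<le> l" if "a \<in> {1..k}" "j \<in> {1..l}" "nu = lam \<or> nu = mu" for a j nu
    unfolding conj_tuple_def using part[OF rev[OF that(1)] that(3)] that(2) by (intro conj_partition_le) auto
  let ?cols = "\<lambda>nu. column_labels k l nu (int l - 1)"
  have st: "?cols nu \<in> states k (2 * l)" for nu
  proof -
    have "length [- int l..int l - 1] = 2 * l" by simp
    then show ?thesis using column_labels_in_states[of k l nu "int l - 1"] by (simp only:)
  qed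
  have "LS k l N lam mu n x m y t = chain (states k (2 * l))
      (map (transfer k) (row_list k t (map x [1..<n + 1]) (map y [1..<m + 1]))) (?cols mu) (?cols lam)"
    by (rule LS_eq_chain_window[OF assms(6,7)]) (use bound in blast)
  also have "\<dots> = t powi (height k (?cols lam) - height k (?cols mu)) *
      chain (states k (2 * l)) (map (transfer k) (row_list k (inverse t) (map y [1..<m + 1]) (map x [1..<n + 1])))
        (hole_state k (?cols mu)) (hole_state k (?cols lam))"
    using chain_states_conjugate[OF assms(2) st[of mu] st[of lam], of "map x [1..<n + 1]" "map y [1..<m + 1]"]
    by (simp add: row_list_def o_def del: upt_Suc)
  also have "height k (?cols lam) - height k (?cols mu) = int (g k l lam) - int (g k l mu)"
    using part_lam part_mu by (simp add: g_eq_height)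
  also have "chain (states k (2 * l)) (map (transfer k) (row_list k (inverse t) (map y [1..<m + 1]) (map x [1..<n + 1])))
        (hole_state k (?cols mu)) (hole_state k (?cols lam)) =
      LS k l N' (conj_tuple k lam) (conj_tuple k mu) m y n x (inverse t)"
    unfolding column_labels_conj[OF part_lam, symmetric] column_labels_conj[OF part_mu, symmetric]
    by (rule LS_eq_chain_window[OF assms(8,9), symmetric]) (use bound' in blast)
  finally show ?thesis .
qed

end
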